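(* Let $\rho\in(-1,1)$ and let $(X,Y)$ be a bivariate random vector with $$(X,Y)\stackrel{d}{=}(RI_1W,\ \rho RI_1W+RI_2z^*(W)),$$ where $(I_1,I_2)$, $R>0$ and $W\in(0,1)$ are mutually independent, $I_1,I_2$ take values in $\{-1,1\}$ with $P\{I_1=I_2=1\}\in(0,1]$, $z^*:[0,1]\to[0,1]$ is a positive measurable function, $R$ has distribution function $F$ with infinite upper endpoint, and the distribution function of $W$ has upper endpoint $1$. Let $a\in(0,1]$ be a constant and put $z(x):=\rho x+z^*(x)$, $x\in[0,1]$. Suppose that there exists $a_\rho\in(1,a/|\rho|)$ such that for some $\varepsilon\in(0,1)$ the function $z$ is decreasing in $V_\varepsilon:=[1/a_\rho-\varepsilon,\,1/a_\rho+\varepsilon]$, and $z(x)\le a/a_\rho$ for all $x\in(1/a_\rho,1]$. Suppose that the inverse $z_\varepsilon$ of $z$ in $V_\varepsilon$ satisfies, as $x\to\infty$, $$z_\varepsilon(a/a_\rho-d/x)-1/a_\rho\sim\frac{cd}{x}\qquad\text{and}\qquad z_\varepsilon(a/a_\rho+d/x)-1/a_\rho\sim-\frac{cd}{x},$$ both locally uniformly for $d>0$, with some $c\in(0,\infty)$. Suppose further that $F\in GMDA(w)$ for some positive scaling function $w$, that with $K_1:=-1/a_\rho$ and $K_2:=ca/a_\rho$ $$P\{W-1/a_\rho\in(K_1u,K_2u)\}\sim L_{K_1,K_2}(u)\,u^{\gamma_a},\qquad u\downarrow0,$$ for some $\gamma_a\in[0,\infty)$ and some locally bounded function $L_{K_1,K_2}$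 slowly varying at $0$, and that $W$ possesses a positive density function $h$ continuous at $1/a_\rho$. Then $a_\rho$ is unique and for any $\eta,\delta\in[0,\infty)$, as $x\to\infty$, $$P\Bigl\{X>x\Bigl[1+\frac{\delta}{v(a_\rho x)}\Bigr],\ Y>ax\Bigl[1+\frac{\eta}{v(a_\rho x)}\Bigr]\Bigr\}\ \sim\ P\{I_1=I_2=1\}\,\frac{h(1/a_\rho)}{a_\rho}\,(ca+1)\exp\Bigl(-\frac{ca\eta+\delta}{ca+1}\Bigr)\frac{\overline F(x_* )}{v(x_* )},$$ locally uniformly in $\delta,\eta$, where $x_*:=a_\rho x$ and $v(x):=xw(x)$, $x>0$.
   Context: $\overline F:=1-F$. $F\in GMDA(w)$, for $F$ with infinite upper endpoint, means $\lim_{x\to\infty}\overline F(x+t/w(x))/\overline F(x)=e^{-t}$ for all $t\in\mathbb R$. $f\sim g$ means that the ratio $f/g$ tends to $1$ in the indicated limit. If $\rho=0$, $a/|\rho|$ is read as $+\infty$. $\stackrel{d}{=}$ denotes equality in distribution.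
   Formalization: The formal statement additionally assumes that z is bounded by some constant strictly less than a/a_ρ on [1/a_ρ+ε, 1]; with only z(x) ≤ a/a_ρ the claim fails, e.g. if z equals a/a_ρ on an interval away from 1/a_ρ. *)

theory Defs
  imports "HOL-Probability.Probability" "HOL-Library.Landau_Symbols"
begin

definition upper_endpoint :: "(real \<Rightarrow> real) \<Rightarrow> ereal" where
  "upper_endpoint F = (SUP x\<in>{x. F x < 1}. ereal x)"

(* Gumbel max-domain of attraction, only for infinite upper endpoint. *)
definition GMDA :: "(real \<Rightarrow> real) \<Rightarrow> (real \<Rightarrow> real) set" where
  "GMDA w = {F. upper_endpoint F = \<infinity> \<and>
     (\<forall>t. ((\<lambda>x. (1 - F (x + t / w x)) / (1 - F x)) \<longlongrightarrow> exp (- t)) at_top)}"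

(* Measurability, which many texts include in the definition, is not required. *)
definition slowly_varying_at_0 :: "(real \<Rightarrow> real) \<Rightarrow> bool" where
  "slowly_varying_at_0 L \<longleftrightarrow>
     (\<forall>\<^sub>F u in at_right 0. L u > 0) \<and>
     (\<forall>t>0. ((\<lambda>u. L (t * u) / L u) \<longlongrightarrow> 1) (at_right 0))"

definition locally_bounded_on :: "'a::topological_space set \<Rightarrow> ('a \<Rightarrow> real) \<Rightarrow> bool" where
  "locally_bounded_on S L \<longleftrightarrow> (\<forall>K. compact K \<and> K \<subseteq> S \<longrightarrow> bounded (L ` K))"

(* f x p \<sim> g x p as x tends along the filter G, locally uniformly for p in S. *)
definition asymp_equiv_loc_unif ::
    "'b filter \<Rightarrow> 'a::topological_space set \<Rightarrow> ('b \<Rightarrow> 'a \<Rightarrow> real) \<Rightarrow> ('b \<Rightarrow> 'a \<Rightarrow> real) \<Rightarrow> bool" where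
  "asymp_equiv_loc_unif G S f g \<longleftrightarrow>
     (\<forall>K. compact K \<and> K \<subseteq> S \<longrightarrow> uniform_limit K (\<lambda>x p. f x p / g x p) (\<lambda>_. 1) G)"

(* Three-variable version of prob_space.indep_vars; needed because the variables may take
   values in different types. *)
definition (in prob_space) indep_var3 ::
    "'b measure \<Rightarrow> ('a \<Rightarrow> 'b) \<Rightarrow> 'c measure \<Rightarrow> ('a \<Rightarrow> 'c) \<Rightarrow> 'd measure \<Rightarrow> ('a \<Rightarrow> 'd) \<Rightarrow> bool" where
  "indep_var3 A f B g C h \<longleftrightarrow>
     random_variable A f \<and> random_variable B g \<and> random_variable C h \<and>
     indep_sets (\<lambda>i. [{f -` S \<inter> space M | S. S \<in> sets A},
                      {g -` S \<inter> space M | S. S \<in> sets B},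
                      {h -` S \<inter> space M | S. S \<in> sets C}] ! i) {..<3}"

(* z is a function on [0,1], hence the intersection. *)
definition V_nbhd :: "real \<Rightarrow> real \<Rightarrow> real set" where
  "V_nbhd r \<epsilon> = {1 / r - \<epsilon> .. 1 / r + \<epsilon>} \<inter> {0..1}"

(* The conditions imposed on a_rho (here r). The inverse of z on V_nbhd is inv_into; outside the
   image of V_nbhd it is a constant, which can never satisfy the two asymptotic relations, so
   these force the image to contain the points a / r - d / x and a / r + d / x for large x. *)
definition admissible ::
    "real \<Rightarrow> real \<Rightarrow> (real \<Rightarrow> real) \<Rightarrow> real \<Rightarrow> real \<Rightarrow> real \<Rightarrow> bool" where
  "admissible \<rho> a z r \<epsilon> c \<longleftrightarrow>
     1 < r \<and> (\<rho> \<noteq> 0 \<longrightarrow> r < a / \<bar>\<rho>\<bar>) \<and> \<epsilon> \<in> {0<..<1} \<and> 0 < c \<and>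
     strict_antimono_on (V_nbhd r \<epsilon>) z \<and>
     (\<forall>x\<in>{1 / r<..1}. z x \<le> a / r) \<and>
     asymp_equiv_loc_unif at_top {0<..}
       (\<lambda>x d. inv_into (V_nbhd r \<epsilon>) z (a / r - d / x) - 1 / r) (\<lambda>x d. c * d / x) \<and>
     asymp_equiv_loc_unif at_top {0<..}
       (\<lambda>x d. inv_into (V_nbhd r \<epsilon>) z (a / r + d / x) - 1 / r) (\<lambda>x d. - (c * d / x))"

end

theory Submission
  imports Defs
begin

text \<open>
  Write \<open>b = 1 / a\<^sub>\<rho>\<close>, \<open>y = a\<^sub>\<rho> x\<close> and \<open>T = 1 - F\<close>. On \<open>I\<^sub>1 = I\<^sub>2 = 1\<close> the event requires
  \<open>R > max (x\<^sub>1 / W) (y\<^sub>1 / z W)\<close> with \<open>x\<^sub>1 = x (1 + \<delta> / v y)\<close> and \<open>y\<^sub>1 = a x (1 + \<eta> / v y)\<close>; the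
  asymptotics of the inverse of \<open>z\<close> say exactly that \<open>z b = a b\<close> and \<open>z' b = - 1 / c\<close>, so this
  threshold is smallest near \<open>W = b\<close>. Substituting \<open>W = b + t / v y\<close> turns the threshold into
  \<open>y + max (\<delta> - t / b) (\<eta> + t / (b c a)) / w y\<close> up to lower order terms, and the result follows by
  dominated convergence from \<open>T (y + s / w y) / T y \<longrightarrow> exp (- s)\<close>. The dominating function comes from
  the bound \<open>T (y + s / w y) \<le> 9 / (s + 2)\<^sup>2 * T y\<close>, which also makes the remaining parts
  negligible, since there \<open>R > k y\<close> for some \<open>k > 1\<close>. Local uniformity is obtained by running the
  argument along arbitrary sequences \<open>(x\<^sub>n, \<delta>\<^sub>n, \<eta>\<^sub>n)\<close>. Uniqueness of \<open>a\<^sub>\<rho>\<close>: if \<open>r < r'\<close> are both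
  admissible, then \<open>a / r = z (1 / r) \<le> a / r'\<close>.
\<close>

section \<open>Tails in the Gumbel max-domain of attraction\<close>

text \<open>\<open>T\<close> stands for \<open>1 - F\<close>. Positivity everywhere is the form that
  the infinite upper endpoint of \<open>F\<close> takes.\<close>

locale gumbel_tail =
  fixes T w :: "real \<Rightarrow> real"
  assumes antimono_tail: "antimono T"
    and tail_pos: "\<And>x. 0 < T x"
    and tail_tendsto_0: "(T \<longlongrightarrow> 0) at_top"
    and scaling_pos: "\<And>x. 0 < x \<Longrightarrow> 0 < w x"
    and tail_ratio: "\<And>t. ((\<lambda>x. T (x + t / w x) / T x) \<longlongrightarrow> exp (- t)) at_top"
begin

lemma tail_le: "x \<le> y \<Longrightarrow> T y \<le> T x"
  using antimono_tail by (auto dest: antimonoD)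

text \<open>\<open>T\<close> at the shifted point is a convergent ratio times \<open>T x\<close>,
  hence tends to 0. As \<open>T\<close> is positive and antitone, a point where it is below
  \<open>T Z\<close> lies beyond \<open>Z\<close>. The content is in negative \<open>t\<close>,
  where nothing is known beforehand about the size of \<open>1 / w\<close>.\<close>

lemma shift_at_top: "filterlim (\<lambda>x. x + t / w x) at_top at_top"
  unfolding filterlim_at_top
proof
  fix Z :: real
  have "((\<lambda>x. T (x + t / w x) / T x * T x) \<longlongrightarrow> exp (- t) * 0) at_top"
    by (intro tendsto_mult tail_ratio tail_tendsto_0)
  moreover have "(\<lambda>x. T (x + t / w x) / T x * T x) = (\<lambda>x. T (x + t / w x))"
    using tail_pos by (auto simp: less_le)
  ultimately have "((\<lambda>x. T (x + t / w x)) \<longlongrightarrow> 0) at_top" by simp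
  from order_tendstoD(2)[OF this tail_pos[of Z]]
  show "\<forall>\<^sub>F x in at_top. Z \<le> x + t / w x"
  proof eventually_elim
    case (elim x)
    then show ?case using tail_le[of "x + t / w x" Z] by linarith
  qed
qed

text \<open>Shifting by \<open>- Z / w x\<close> still leads to nonnegative points eventually, which
  says \<open>x * w x\<close> is at least \<open>Z\<close>.\<close>

lemma scaled_at_top: "filterlim (\<lambda>x. x * w x) at_top at_top"
  unfolding filterlim_at_top
proof
  fix Z :: real
  have "\<forall>\<^sub>F x in at_top. 0 \<le> x + (- Z) / w x"
    using shift_at_top[of "- Z"] unfolding filterlim_at_top by blast
  then show "\<forall>\<^sub>F x in at_top. Z \<le> x * w x"
    using eventually_gt_at_top[of 0]
  proof eventually_elim
    case (elim x)
    then show ?case using scaling_pos[of x] by (simp add: field_simps)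
  qed
qed

text \<open>If the increment \<open>1 / w\<close> grew by more than the factor \<open>3 / 2\<close> over one step, then one step
  back from \<open>y = x + 1 / w x\<close> would increase \<open>T\<close> by at least \<open>exp (3 / 2)\<close> instead of
  \<open>exp 1\<close>.\<close>

lemma step_bounds:
  "\<forall>\<^sub>F x in at_top. T (x + 1 / w x) \<le> 4 / 9 * T x \<and> 1 / w (x + 1 / w x) \<le> 3 / 2 * (1 / w x)"
proof -
  \<comment> \<open>4/9 is the inverse square of the growth factor 3/2: per step the tail loses the
    square of what the step length may gain, and this is the source of the quadratic decay in
    \<open>tail_bound\<close>. The constant is possible because exp 1 is at least 5/2 > 9/4.\<close>
  have e1: "exp (- 1 :: real) < 4 / 9"
  proof -
    have "(9 / 4 :: real) < exp 1"
      using exp_lower_Taylor_quadratic[of "1::real"] by (simp add: field_simps)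
    then show ?thesis by (simp add: exp_minus field_simps)
  qed
  have L1: "((\<lambda>x. T ((x + 1 / w x) + (- 1) / w (x + 1 / w x)) / T (x + 1 / w x)) \<longlongrightarrow> exp (- (- 1))) at_top"
    by (rule filterlim_compose[OF tail_ratio shift_at_top])
  \<comment> \<open>The point \<open>x - 1 / (2 * w x)\<close> lies 3/2 old increments behind
    \<open>x + 1 / w x\<close>. The number \<open>m\<close> below separates the two rival limits exp
    1 and exp (3/2).\<close>
  have "((\<lambda>x. (T (x + (- 1 / 2) / w x) / T x) / (T (x + 1 / w x) / T x)) \<longlongrightarrow> exp (- (- 1 / 2)) / exp (- 1)) at_top"
    by (intro tendsto_divide tail_ratio) auto
  moreover have "exp (- (- 1 / 2)) / exp (- 1) = exp (3 / 2 :: real)"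
    by (simp flip: exp_diff)
  ultimately have L2: "((\<lambda>x. (T (x + (- 1 / 2) / w x) / T x) / (T (x + 1 / w x) / T x)) \<longlongrightarrow> exp (3 / 2)) at_top"
    by simp
  obtain m :: real where m: "exp 1 < m" "m < exp (3 / 2)"
    using dense[of "exp 1" "exp (3 / 2 :: real)"] by auto
  have "\<forall>\<^sub>F x in at_top. T (x + 1 / w x) / T x < 4 / 9"
    using order_tendstoD(2)[OF tail_ratio[of 1] e1] .
  moreover have "\<forall>\<^sub>F x in at_top. T ((x + 1 / w x) + (- 1) / w (x + 1 / w x)) / T (x + 1 / w x) < m"
    using order_tendstoD(2)[OF L1] m by simp
  moreover have "\<forall>\<^sub>F x in at_top. m < (T (x + (- 1 / 2) / w x) / T x) / (T (x + 1 / w x) / T x)"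
    using order_tendstoD(1)[OF L2] m by simp
  ultimately show ?thesis using eventually_gt_at_top[of 0]
  proof eventually_elim
    case (elim x)
    define y where "y = x + 1 / w x"
    have pos: "T x > 0" "T y > 0" by (rule tail_pos)+
    have "1 / w y \<le> 3 / 2 * (1 / w x)"
    proof (rule ccontr)
      assume "\<not> ?thesis"
      then have "y - 1 / w y \<le> x - 1 / 2 * (1 / w x)" unfolding y_def by linarith
      then have "y + (- 1) / w y \<le> x + (- 1 / 2) / w x" by simp
      then have "T (x + (- 1 / 2) / w x) \<le> T (y + (- 1) / w y)" by (rule tail_le)
      then have "T (x + (- 1 / 2) / w x) / T y \<le> T (y + (- 1) / w y) / T y"
        using pos by (simp add: divide_right_mono)
      with elim(2,3) pos show False by (simp add: y_def)
    qed
    moreover have "T y \<le> 4 / 9 * T x" using elim(1) pos by (simp add: y_def field_simps)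
    ultimately show ?case by (simp add: y_def)
  qed
qed

text \<open>Iterate \<open>step_bounds\<close>. By the geometric sum, n steps move the point by at
  most \<open>2 * ((3/2)^n - 1) / w x\<close>, while \<open>T\<close> falls by the factor
  \<open>(4/9)^n\<close>. For the last n whose displacement bound does not exceed \<open>t\<close>,
  the next power satisfies (3/2)^(n+1) > (t+2)/2, and squaring gives the claim. The threshold for
  \<open>x\<close> comes from \<open>step_bounds\<close> alone, hence the uniformity in
  \<open>t\<close>.\<close>

lemma tail_bound:
  "\<forall>\<^sub>F x in at_top. \<forall>t\<ge>0. T (x + t / w x) \<le> 9 / (t + 2)\<^sup>2 * T x"
proof -
  obtain x1 where x1: "\<And>x. x \<ge> x1 \<Longrightarrow>
      T (x + 1 / w x) \<le> 4 / 9 * T x \<and> 1 / w (x + 1 / w x) \<le> 3 / 2 * (1 / w x)"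
    using step_bounds unfolding eventually_at_top_linorder by blast
  define x0 where "x0 = max x1 1"
  have x0: "x0 > 0" "\<And>x. x \<ge> x0 \<Longrightarrow>
      T (x + 1 / w x) \<le> 4 / 9 * T x \<and> 1 / w (x + 1 / w x) \<le> 3 / 2 * (1 / w x)"
    using x1 by (auto simp: x0_def)
  have "T (x + t / w x) \<le> 9 / (t + 2)\<^sup>2 * T x" if x: "x \<ge> x0" and t: "t \<ge> 0" for x t
  proof -
    define X where "X n = ((\<lambda>y. y + 1 / w y) ^^ n) x" for n
    have X: "x0 \<le> X n \<and> 1 / w (X n) \<le> (3 / 2) ^ n / w x \<and> X n \<le> x + 2 * ((3 / 2) ^ n - 1) / w x
        \<and> T (X n) \<le> (4 / 9) ^ n * T x" for n
    proof (induction n)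
      case 0
      then show ?case using x by (simp add: X_def)
    next
      case (Suc n)
      have S: "X (Suc n) = X n + 1 / w (X n)" by (simp add: X_def)
      have wp: "w (X n) > 0" "w x > 0" using Suc x0(1) x by (auto intro!: scaling_pos)
      have step: "T (X (Suc n)) \<le> 4 / 9 * T (X n)" "1 / w (X (Suc n)) \<le> 3 / 2 * (1 / w (X n))"
        using x0(2)[of "X n"] Suc unfolding S by auto
      have "x0 \<le> X (Suc n)" using Suc wp unfolding S by (simp add: add_increasing2)
      moreover have "1 / w (X (Suc n)) \<le> (3 / 2) ^ Suc n / w x"
        using step(2) Suc by simp
      moreover have "X (Suc n) \<le> x + 2 * ((3 / 2) ^ Suc n - 1) / w x"
      proof -
        have "X (Suc n) \<le> x + 2 * ((3 / 2) ^ n - 1) / w x + (3 / 2) ^ n / w x"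
          using Suc unfolding S by linarith
        also have "\<dots> = x + 2 * ((3 / 2) ^ Suc n - 1) / w x" using wp by (simp add: field_simps)
        finally show ?thesis .
      qed
      moreover have "T (X (Suc n)) \<le> (4 / 9) ^ Suc n * T x"
        using step(1) Suc by simp
      ultimately show ?case by blast
    qed
    have wx: "w x > 0" using x0(1) x by (auto intro!: scaling_pos)
    obtain n0 where n0: "(t + 2) / 2 < (3 / 2) ^ n0"
      using real_arch_pow[of "3 / 2 :: real" "(t + 2) / 2"] by auto
    \<comment> \<open>\<open>m\<close> is the first step count whose displacement bound exceeds
      \<open>t\<close>. It is not 0 because \<open>t\<close> is nonnegative, so its predecessor n
      exists and does not overshoot.\<close>
    define m where "m = (LEAST n. (t + 2) / 2 < (3 / 2 :: real) ^ n)"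
    have m: "(t + 2) / 2 < (3 / 2) ^ m" unfolding m_def by (rule LeastI[of _ n0]) (rule n0)
    have "m \<noteq> 0"
    proof
      assume "m = 0"
      with m t show False by simp
    qed
    then obtain n where n: "m = Suc n" by (cases m) auto
    have "\<not> (t + 2) / 2 < (3 / 2) ^ n" using not_less_Least[of n "\<lambda>n. (t + 2) / 2 < (3 / 2 :: real) ^ n"] n m_def by simp
    then have le: "2 * ((3 / 2) ^ n - 1) \<le> t" by simp
    have "2 * ((3 / 2) ^ n - 1) / w x \<le> t / w x" using le wx by (intro divide_right_mono) auto
    then have "T (x + t / w x) \<le> T (X n)" using X[of n] by (intro tail_le) linarith
    also have "\<dots> \<le> (4 / 9) ^ n * T x" using X by blast
    also have "\<dots> \<le> 9 / (t + 2)\<^sup>2 * T x"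
    proof (rule mult_right_mono)
      have "(t + 2) / 3 \<le> (3 / 2) ^ n" using m n by simp
      then have "((t + 2) / 3)\<^sup>2 \<le> ((3 / 2) ^ n)\<^sup>2" using t by (intro power_mono) auto
      moreover have "((3 / 2) ^ n)\<^sup>2 * (4 / 9) ^ n = (1 :: real)"
        unfolding power2_eq_square power_mult_distrib[symmetric] by simp
      then have "((3 / 2) ^ n)\<^sup>2 = (1 :: real) / (4 / 9) ^ n"
        by (simp add: eq_divide_eq)
      ultimately have "(t + 2)\<^sup>2 / 9 \<le> 1 / (4 / 9) ^ n" by (simp only: power_divide) simp
      then show "(4 / 9) ^ n \<le> 9 / (t + 2)\<^sup>2" using t by (simp add: field_simps)
    qed (use tail_pos[of x] in simp)
    finally show ?thesis .
  qed
  then show ?thesis unfolding eventually_at_top_linorder by blast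
qed

text \<open>With v = \<open>x * w x\<close> the point \<open>k * x\<close> is the shift of
  \<open>x\<close> by \<open>(k - 1) * v / w x\<close>, so \<open>tail_bound\<close> leaves 9v /
  ((k-1)v + 2)^2, which is of order 1/v. This discards every event that forces R > k y for a fixed k
  > 1.\<close>

lemma tail_dilation_negligible:
  assumes "1 < k"
  shows "((\<lambda>x. x * w x * T (k * x) / T x) \<longlongrightarrow> 0) at_top"
proof (rule tendsto_sandwich)
  have "((\<lambda>v::real. 9 * v / ((k - 1) * v + 2)\<^sup>2) \<longlongrightarrow> 0) at_top"
  proof (rule tendsto_sandwich)
    show "\<forall>\<^sub>F v in at_top. (0::real) \<le> 9 * v / ((k - 1) * v + 2)\<^sup>2"
      using eventually_gt_at_top[of 0] by eventually_elim simp
    show "\<forall>\<^sub>F v in at_top. 9 * v / ((k - 1) * v + 2)\<^sup>2 \<le> 9 / (k - 1)\<^sup>2 * (1 / v)"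
      using eventually_gt_at_top[of 0]
    proof eventually_elim
      case (elim v)
      have "((k - 1) * v)\<^sup>2 \<le> ((k - 1) * v + 2)\<^sup>2" using assms elim by (intro power_mono) auto
      then have "9 * v / ((k - 1) * v + 2)\<^sup>2 \<le> 9 * v / ((k - 1) * v)\<^sup>2"
        using assms elim by (intro divide_left_mono mult_pos_pos zero_less_power add_pos_pos) auto
      also have "\<dots> = 9 / (k - 1)\<^sup>2 * (1 / v)"
        using elim assms by (simp add: power_mult_distrib) (simp add: power2_eq_square)
      finally show ?case .
    qed
    have "((\<lambda>v::real. 9 / (k - 1)\<^sup>2 * (1 / v)) \<longlongrightarrow> 9 / (k - 1)\<^sup>2 * 0) at_top"
      by (intro tendsto_mult tendsto_const tendsto_divide_0[OF tendsto_const] filterlim_at_top_imp_at_infinity filterlim_ident)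
    then show "((\<lambda>v::real. 9 / (k - 1)\<^sup>2 * (1 / v)) \<longlongrightarrow> 0) at_top" by simp
  qed (rule tendsto_const)
  from filterlim_compose[OF this scaled_at_top]
  have bound_lim: "((\<lambda>x. 9 * (x * w x) / ((k - 1) * (x * w x) + 2)\<^sup>2) \<longlongrightarrow> 0) at_top" .
  show "\<forall>\<^sub>F x in at_top. 0 \<le> x * w x * T (k * x) / T x"
    using eventually_gt_at_top[of 0]
    by eventually_elim (use tail_pos scaling_pos in \<open>auto intro!: divide_nonneg_nonneg mult_nonneg_nonneg less_imp_le\<close>)
  show "\<forall>\<^sub>F x in at_top. x * w x * T (k * x) / T x \<le> 9 * (x * w x) / ((k - 1) * (x * w x) + 2)\<^sup>2"
    using tail_bound eventually_gt_at_top[of 0]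
  proof eventually_elim
    case (elim x)
    have wx: "w x > 0" using elim by (intro scaling_pos)
    have "x + ((k - 1) * (x * w x)) / w x = k * x" using wx by (simp add: field_simps)
    moreover have "0 \<le> (k - 1) * (x * w x)" using wx elim assms by simp
    ultimately have "T (k * x) \<le> 9 / ((k - 1) * (x * w x) + 2)\<^sup>2 * T x"
      using elim(1) by metis
    then have "T (k * x) / T x \<le> 9 / ((k - 1) * (x * w x) + 2)\<^sup>2"
      using tail_pos[of x] by (simp add: divide_le_eq)
    then have "x * w x * (T (k * x) / T x) \<le> x * w x * (9 / ((k - 1) * (x * w x) + 2)\<^sup>2)"
      using wx elim by (intro mult_left_mono) auto
    then show ?case by (simp add: mult_ac)
  qed
  show "((\<lambda>x. 9 * (x * w x) / ((k - 1) * (x * w x) + 2)\<^sup>2) \<longlongrightarrow> 0) at_top"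
    by (rule bound_lim)
qed (rule tendsto_const)

text \<open>Monotonicity of \<open>T\<close> traps the moving shift between two fixed shifts close
  to \<open>t\<close>, and exp is continuous. This version makes the argument along sequences of
  parameters possible.\<close>

lemma tail_ratio_moving:
  assumes X: "filterlim X at_top G" and \<tau>: "(\<tau> \<longlongrightarrow> t) G"
  shows "((\<lambda>n. T (X n + \<tau> n / w (X n)) / T (X n)) \<longlongrightarrow> exp (- t)) G"
proof (rule order_tendstoI)
  have lim: "((\<lambda>n. T (X n + s / w (X n)) / T (X n)) \<longlongrightarrow> exp (- s)) G" for s
    by (rule filterlim_compose[OF tail_ratio X])
  have Xp: "\<forall>\<^sub>F n in G. 0 < X n" using X by (simp add: filterlim_at_top_dense)
  fix l
  {
    assume "l < exp (- t)"
    \<comment> \<open>Keeping \<open>m\<close> positive allows the fixed shift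
      \<open>s = - ln m\<close>, for which \<open>exp (- s) = m\<close>.\<close>
    then obtain m where m: "max l 0 < m" "m < exp (- t)"
      using dense[of "max l 0" "exp (- t)"] by auto
    define s where "s = - ln m"
    have s: "l < exp (- s)" "t < s"
      using m ln_less_cancel_iff[of m "exp (- t)"] by (auto simp: s_def)
    from order_tendstoD(1)[OF lim s(1)] order_tendstoD(2)[OF \<tau> s(2)] Xp
    show "\<forall>\<^sub>F n in G. l < T (X n + \<tau> n / w (X n)) / T (X n)"
    proof eventually_elim
      case (elim n)
      have "T (X n + s / w (X n)) \<le> T (X n + \<tau> n / w (X n))"
        using elim scaling_pos[of "X n"] by (intro tail_le) (auto simp: field_simps)
      then have "T (X n + s / w (X n)) / T (X n) \<le> T (X n + \<tau> n / w (X n)) / T (X n)"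
        using tail_pos[of "X n"] by (simp add: divide_right_mono)
      with elim(1) show ?case by simp
    qed
  }
  {
    assume "exp (- t) < l"
    then obtain m where m: "exp (- t) < m" "m < l"
      using dense[of "exp (- t)" l] by auto
    then have "0 < m" by (meson exp_gt_zero order.strict_trans)
    define s where "s = - ln m"
    have s: "exp (- s) < l" "s < t"
      using m \<open>0 < m\<close> ln_less_cancel_iff[of "exp (- t)" m] by (auto simp: s_def)
    from order_tendstoD(2)[OF lim s(1)] order_tendstoD(1)[OF \<tau> s(2)] Xp
    show "\<forall>\<^sub>F n in G. T (X n + \<tau> n / w (X n)) / T (X n) < l"
    proof eventually_elim
      case (elim n)
      have "T (X n + \<tau> n / w (X n)) \<le> T (X n + s / w (X n))"
        using elim scaling_pos[of "X n"] by (intro tail_le) (auto simp: field_simps)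
      then have "T (X n + \<tau> n / w (X n)) / T (X n) \<le> T (X n + s / w (X n)) / T (X n)"
        using tail_pos[of "X n"] by (simp add: divide_right_mono)
      with elim(1) show ?case by simp
    qed
  }
qed

end

section \<open>The function z at an admissible point\<close>

text \<open>Off the image, \<open>inv_into\<close> has one constant value q. Its normalised distance
  \<open>x * (q - b) / k\<close> is 0 if q = b and unbounded otherwise, so it cannot stay near 1.
  Hence the asymptotic relation itself forces the arguments into the image.\<close>

lemma inv_into_asymp_imp_image:
  fixes z :: "real \<Rightarrow> real"
  assumes lim: "((\<lambda>x. (inv_into V z (A + s / x) - b) / (k / x)) \<longlongrightarrow> 1) at_top" and "k \<noteq> 0"
  shows "\<forall>\<^sub>F x in at_top. A + s / x \<in> z ` V"
    and "((\<lambda>x. x * (inv_into V z (A + s / x) - b)) \<longlongrightarrow> k) at_top"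
proof -
  define q where "q = (SOME y :: real. False)"
  have q: "inv_into V z y = q" if "y \<notin> z ` V" for y
  proof -
    have "(\<lambda>x. x \<in> V \<and> z x = y) = (\<lambda>_. False)" using that by auto
    then show ?thesis unfolding inv_into_def q_def by simp
  qed
  have "\<forall>\<^sub>F x in at_top. \<bar>(inv_into V z (A + s / x) - b) / (k / x) - 1\<bar> < 1 / 2"
    using tendstoD[OF lim, of "1 / 2"] by (simp add: dist_real_def)
  moreover have "\<forall>\<^sub>F x in at_top. q = b \<or> 2 * \<bar>k\<bar> / \<bar>q - b\<bar> < x"
    by (auto intro: eventually_mono[OF eventually_gt_at_top])
  ultimately show "\<forall>\<^sub>F x in at_top. A + s / x \<in> z ` V"
    using eventually_gt_at_top[of 0]
  proof eventually_elim
    case (elim x)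
    show ?case
    proof (rule ccontr)
      assume "A + s / x \<notin> z ` V"
      then have *: "\<bar>(q - b) / (k / x) - 1\<bar> < 1 / 2" using elim(1) q by simp
      then have "q \<noteq> b" by auto
      then have "2 * \<bar>k\<bar> < x * \<bar>q - b\<bar>" using elim(2) by (simp add: field_simps)
      then have "2 < \<bar>(q - b) / (k / x)\<bar>"
        using elim(3) \<open>k \<noteq> 0\<close> by (simp add: abs_mult less_divide_eq mult.commute)
      with * show False by linarith
    qed
  qed
  have "((\<lambda>x. k * ((inv_into V z (A + s / x) - b) / (k / x))) \<longlongrightarrow> k * 1) at_top"
    by (intro tendsto_mult tendsto_const lim)
  then show "((\<lambda>x. x * (inv_into V z (A + s / x) - b)) \<longlongrightarrow> k) at_top"
    using \<open>k \<noteq> 0\<close> by (simp add: mult.commute)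
qed

lemma asymp_equiv_loc_unifD:
  assumes "asymp_equiv_loc_unif G S f g" "compact K" "K \<subseteq> S"
  shows "uniform_limit K (\<lambda>x p. f x p / g x p) (\<lambda>_. 1) G"
  using assms unfolding asymp_equiv_loc_unif_def by blast

section \<open>Value and derivative of z at 1 / r\<close>

context
  fixes \<rho> a r \<epsilon> c :: real and z :: "real \<Rightarrow> real"
  assumes adm: "admissible \<rho> a z r \<epsilon> c"
begin

lemma admissible_pos: "1 < r" "0 < 1 / r" "1 / r < 1" "0 < \<epsilon>" "0 < c"
  using adm by (auto simp: admissible_def)

lemma admissible_antimono:
  "x \<in> V_nbhd r \<epsilon> \<Longrightarrow> y \<in> V_nbhd r \<epsilon> \<Longrightarrow> x < y \<Longrightarrow> z y < z x"
  using adm by (auto simp: admissible_def monotone_on_def)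

text \<open>The single value d = 1 is enough: other speeds arise later from the substitution x = q /
  u. Values below a / r have their preimages to the right of 1 / r.\<close>

lemma admissible_inverse_right:
  "\<forall>\<^sub>F x in at_top. a / r - 1 / x \<in> z ` V_nbhd r \<epsilon>"
  "((\<lambda>x. x * (inv_into (V_nbhd r \<epsilon>) z (a / r - 1 / x) - 1 / r)) \<longlongrightarrow> c) at_top"
proof -
  have "uniform_limit {1} (\<lambda>x d. (inv_into (V_nbhd r \<epsilon>) z (a / r - d / x) - 1 / r) / (c * d / x)) (\<lambda>_. 1) at_top"
    by (rule asymp_equiv_loc_unifD[of _ "{0<..}"]) (use adm in \<open>auto simp: admissible_def\<close>)
  from tendsto_uniform_limitI[OF this, of 1]
  have "((\<lambda>x. (inv_into (V_nbhd r \<epsilon>) z (a / r + (- 1) / x) - 1 / r) / (c / x)) \<longlongrightarrow> 1) at_top" by simp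
  from inv_into_asymp_imp_image[OF this] admissible_pos
  show "\<forall>\<^sub>F x in at_top. a / r - 1 / x \<in> z ` V_nbhd r \<epsilon>"
    "((\<lambda>x. x * (inv_into (V_nbhd r \<epsilon>) z (a / r - 1 / x) - 1 / r)) \<longlongrightarrow> c) at_top" by simp_all
qed

lemma admissible_inverse_left:
  "\<forall>\<^sub>F x in at_top. a / r + 1 / x \<in> z ` V_nbhd r \<epsilon>"
  "((\<lambda>x. x * (inv_into (V_nbhd r \<epsilon>) z (a / r + 1 / x) - 1 / r)) \<longlongrightarrow> - c) at_top"
proof -
  have "uniform_limit {1} (\<lambda>x d. (inv_into (V_nbhd r \<epsilon>) z (a / r + d / x) - 1 / r) / (- (c * d / x))) (\<lambda>_. 1) at_top"
    by (rule asymp_equiv_loc_unifD[of _ "{0<..}"]) (use adm in \<open>auto simp: admissible_def\<close>)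
  from tendsto_uniform_limitI[OF this, of 1]
  have "((\<lambda>x. (inv_into (V_nbhd r \<epsilon>) z (a / r + 1 / x) - 1 / r) / (- c / x)) \<longlongrightarrow> 1) at_top" by simp
  from inv_into_asymp_imp_image[OF this] admissible_pos
  show "\<forall>\<^sub>F x in at_top. a / r + 1 / x \<in> z ` V_nbhd r \<epsilon>"
    "((\<lambda>x. x * (inv_into (V_nbhd r \<epsilon>) z (a / r + 1 / x) - 1 / r)) \<longlongrightarrow> - c) at_top" by simp_all
qed

lemma admissible_nbhd: "\<forall>\<^sub>F u in at_right 0. 1 / r + u \<in> V_nbhd r \<epsilon> \<and> 1 / r - u \<in> V_nbhd r \<epsilon>"
proof -
  have "\<forall>\<^sub>F u in at_right 0. u < min \<epsilon> (min (1 / r) (1 - 1 / r))"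
    using admissible_pos by (intro order_tendstoD(2)[OF tendsto_ident_at]) auto
  then show ?thesis using eventually_at_right_less[of "0::real"]
    by eventually_elim (auto simp: V_nbhd_def)
qed

text \<open>The order criterion for limits with the bounds written as -1/q. In this form a bound on
  a difference quotient with increment u amounts to comparing z with the level that differs from a /
  r by u / q.\<close>

lemma quotient_bounds_imp_tendsto:
  fixes D :: "real \<Rightarrow> real"
  assumes lower: "\<And>q. 0 < q \<Longrightarrow> q < c \<Longrightarrow> \<forall>\<^sub>F u in G. - (1 / q) < D u"
    and upper: "\<And>q. c < q \<Longrightarrow> \<forall>\<^sub>F u in G. D u < - (1 / q)"
  shows "(D \<longlongrightarrow> - (1 / c)) G"
proof (rule order_tendstoI)
  note c = admissible_pos(5)
  fix l
  {
    assume l: "l < - (1 / c)"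
    moreover have "0 < 1 / c" using c by simp
    ultimately have "l < 0" by linarith
    with l c have "0 < - 1 / l" "- 1 / l < c" by (auto simp: field_simps)
    from lower[OF this] show "\<forall>\<^sub>F u in G. l < D u" by simp
  }
  {
    assume "- (1 / c) < l"
    \<comment> \<open>The given bound \<open>l\<close> may be nonnegative and then is not of the
      form -1/q with q > 0; a negative \<open>m\<close> below it is.\<close>
    then obtain m where m: "- (1 / c) < m" "m < min l 0"
      using dense[of "- (1 / c)" "min l 0"] c by auto
    then have "c < - 1 / m" using c by (auto simp: field_simps)
    from upper[OF this] show "\<forall>\<^sub>F u in G. D u < l"
      by eventually_elim (use m in simp)
  }
qed

text \<open>The substitution x = q / u turns asymptotics at infinity into a first-order expansion at
  0 with slope k / q.\<close>

lemma scaled_at_right_0: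
  fixes q k :: real and y :: "real \<Rightarrow> real"
  assumes lim: "((\<lambda>x. x * y x) \<longlongrightarrow> k) at_top" and "0 < q"
  shows "((\<lambda>u. y (q / u) / u) \<longlongrightarrow> k / q) (at_right 0)"
proof -
  have "filterlim (\<lambda>u. q * inverse u) at_top (at_right 0)"
    by (rule filterlim_tendsto_pos_mult_at_top[OF tendsto_const \<open>0 < q\<close> filterlim_inverse_at_top_right])
  from filterlim_compose[OF lim this]
  have "((\<lambda>u. q * inverse u * y (q * inverse u) / q) \<longlongrightarrow> k / q) (at_right 0)"
    by (rule tendsto_divide) (use \<open>0 < q\<close> in auto)
  then show ?thesis using \<open>0 < q\<close> by (simp add: field_simps)
qed

lemma eventually_scaled_at_right_0:
  fixes q :: real
  assumes "\<forall>\<^sub>F x in at_top. P x" and "0 < q"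
  shows "\<forall>\<^sub>F u in at_right 0. P (q / u)"
proof -
  have "filterlim (\<lambda>u. q * inverse u) at_top (at_right 0)"
    by (rule filterlim_tendsto_pos_mult_at_top[OF tendsto_const \<open>0 < q\<close> filterlim_inverse_at_top_right])
  from eventually_compose_filterlim[OF assms(1) this] show ?thesis by (simp add: field_simps)
qed

text \<open>The preimage of a / r - 1 / x lies to the right of 1 / r and that of a / r + 1 / x to
  the left. As z decreases, z (1 / r) is squeezed between these two levels.\<close>

lemma admissible_value: "z (1 / r) = a / r"
proof (rule antisym)
  have b: "1 / r \<in> V_nbhd r \<epsilon>" using admissible_pos by (auto simp: V_nbhd_def)
  have lim: "((\<lambda>x. a / r + s / x) \<longlongrightarrow> a / r) at_top" for s
    using tendsto_add[OF tendsto_const tendsto_divide_0[OF tendsto_const filterlim_at_top_imp_at_infinity[OF filterlim_ident]], of "a / r" s] by simp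
  have "\<forall>\<^sub>F x in at_top. a / r + (- 1) / x \<le> z (1 / r)"
    using admissible_inverse_right(1) order_tendstoD(1)[OF admissible_inverse_right(2) admissible_pos(5)] eventually_gt_at_top[of 0]
  proof eventually_elim
    case (elim x)
    have "1 / r < inv_into (V_nbhd r \<epsilon>) z (a / r - 1 / x)" using elim by (simp add: zero_less_mult_iff)
    from admissible_antimono[OF b inv_into_into[OF elim(1)] this] f_inv_into_f[OF elim(1)]
    show ?case by simp
  qed
  from tendsto_upperbound[OF lim this] show "a / r \<le> z (1 / r)" by simp
  have neg: "- c < 0" using admissible_pos by simp
  have "\<forall>\<^sub>F x in at_top. z (1 / r) \<le> a / r + 1 / x"
    using admissible_inverse_left(1) order_tendstoD(2)[OF admissible_inverse_left(2) neg] eventually_gt_at_top[of 0]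
  proof eventually_elim
    case (elim x)
    have "inv_into (V_nbhd r \<epsilon>) z (a / r + 1 / x) < 1 / r" using elim by (simp add: mult_less_0_iff)
    from admissible_antimono[OF inv_into_into[OF elim(1)] b this] f_inv_into_f[OF elim(1)]
    show ?case by simp
  qed
  from tendsto_lowerbound[OF lim this] show "z (1 / r) \<le> a / r" by simp
qed

text \<open>The hypotheses describe z only along preimages; monotonicity carries this over to all
  nearby points. The point \<open>yr (q / u)\<close> is 1/r + (c/q) u + o(u) and has the value a/r -
  u/q. If q < c it lies beyond 1/r + u, so the difference quotient there exceeds -1/q; if q > c the
  inequality reverses. The points \<open>yl (q / u)\<close> serve the left side in the same
  way.\<close>

lemma admissible_DERIV: "(z has_real_derivative - (1 / c)) (at (1 / r))"
proof -
  define V where "V = V_nbhd r \<epsilon>"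
  define yr where "yr x = inv_into V z (a / r - 1 / x)" for x
  define yl where "yl x = inv_into V z (a / r + 1 / x)" for x
  note c = admissible_pos(5)
  note anti = admissible_antimono[folded V_def]
  have nb: "\<forall>\<^sub>F u in at_right 0. 1 / r + u \<in> V \<and> 1 / r - u \<in> V"
    unfolding V_def by (rule admissible_nbhd)
  have yr: "\<forall>\<^sub>F u in at_right 0. yr (q / u) \<in> V \<and> z (yr (q / u)) = a / r - u / q" if "0 < q" for q
    using eventually_scaled_at_right_0[OF admissible_inverse_right(1) that]
  proof eventually_elim
    case (elim u)
    from f_inv_into_f[OF elim] inv_into_into[OF elim] show ?case by (simp add: V_def yr_def)
  qed
  have yr_lim: "((\<lambda>u. (yr (q / u) - 1 / r) / u) \<longlongrightarrow> c / q) (at_right 0)" if "0 < q" for q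
    unfolding V_def yr_def by (rule scaled_at_right_0[OF admissible_inverse_right(2) that])
  have yl: "\<forall>\<^sub>F u in at_right 0. yl (q / u) \<in> V \<and> z (yl (q / u)) = a / r + u / q" if "0 < q" for q
    using eventually_scaled_at_right_0[OF admissible_inverse_left(1) that]
  proof eventually_elim
    case (elim u)
    from f_inv_into_f[OF elim] inv_into_into[OF elim] show ?case by (simp add: V_def yl_def)
  qed
  have yl_lim: "((\<lambda>u. (yl (q / u) - 1 / r) / u) \<longlongrightarrow> - c / q) (at_right 0)" if "0 < q" for q
    unfolding V_def yl_def by (rule scaled_at_right_0[OF admissible_inverse_left(2) that])
  have right: "((\<lambda>u. (z (1 / r + u) - z (1 / r)) / u) \<longlongrightarrow> - (1 / c)) (at_right 0)"
  proof (rule quotient_bounds_imp_tendsto)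
    fix q assume q: "0 < q" "q < c"
    then have "1 < c / q" by (simp add: field_simps)
    from order_tendstoD(1)[OF yr_lim[OF q(1)] this] yr[OF q(1)] nb eventually_at_right_less
    show "\<forall>\<^sub>F u in at_right 0. - (1 / q) < (z (1 / r + u) - z (1 / r)) / u"
    proof eventually_elim
      case (elim u)
      then have "1 / r + u < yr (q / u)" by (simp add: field_simps)
      from anti[OF _ _ this] elim have "a / r - u / q < z (1 / r + u)" by simp
      then have "- (u / q) / u < (z (1 / r + u) - z (1 / r)) / u"
        using elim unfolding admissible_value by (intro divide_strict_right_mono) linarith+
      then show ?case using elim by simp
    qed
  next
    fix q assume q: "c < q"
    then have q0: "0 < q" using c by simp
    with q have "c / q < 1" by (simp add: field_simps)
    from order_tendstoD(2)[OF yr_lim[OF q0] this] yr[OF q0] nb eventually_at_right_less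
    show "\<forall>\<^sub>F u in at_right 0. (z (1 / r + u) - z (1 / r)) / u < - (1 / q)"
    proof eventually_elim
      case (elim u)
      then have "yr (q / u) < 1 / r + u" by (simp add: field_simps)
      from anti[OF _ _ this] elim have "z (1 / r + u) < a / r - u / q" by simp
      then have "(z (1 / r + u) - z (1 / r)) / u < - (u / q) / u"
        using elim unfolding admissible_value by (intro divide_strict_right_mono) linarith+
      then show ?case using elim by simp
    qed
  qed
  have left: "((\<lambda>u. (z (1 / r + - u) - z (1 / r)) / (- u)) \<longlongrightarrow> - (1 / c)) (at_right 0)"
  proof (rule quotient_bounds_imp_tendsto)
    fix q assume q: "0 < q" "q < c"
    then have "- c / q < - 1" by (simp add: field_simps)
    from order_tendstoD(2)[OF yl_lim[OF q(1)] this] yl[OF q(1)] nb eventually_at_right_less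
    show "\<forall>\<^sub>F u in at_right 0. - (1 / q) < (z (1 / r + - u) - z (1 / r)) / (- u)"
    proof eventually_elim
      case (elim u)
      then have "yl (q / u) < 1 / r - u" by (simp add: field_simps)
      from anti[OF _ _ this] elim have "z (1 / r + - u) < a / r + u / q" by simp
      then have "(z (1 / r + - u) - z (1 / r)) / u < (u / q) / u"
        using elim unfolding admissible_value by (intro divide_strict_right_mono) linarith+
      then show ?case using elim by simp
    qed
  next
    fix q assume q: "c < q"
    then have q0: "0 < q" using c by simp
    with q have "- 1 < - c / q" by (simp add: field_simps)
    from order_tendstoD(1)[OF yl_lim[OF q0] this] yl[OF q0] nb eventually_at_right_less
    show "\<forall>\<^sub>F u in at_right 0. (z (1 / r + - u) - z (1 / r)) / (- u) < - (1 / q)"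
    proof eventually_elim
      case (elim u)
      then have "1 / r - u < yl (q / u)" by (simp add: field_simps)
      from anti[OF _ _ this] elim have "a / r + u / q < z (1 / r + - u)" by simp
      then have "(u / q) / u < (z (1 / r + - u) - z (1 / r)) / u"
        using elim unfolding admissible_value by (intro divide_strict_right_mono) linarith+
      then show ?case using elim by simp
    qed
  qed
  show ?thesis
    unfolding DERIV_def filterlim_at_split filterlim_at_left_to_right minus_zero
    using left right by blast
qed

end

lemma admissible_unique:
  assumes "admissible \<rho> a z r \<epsilon> c" "admissible \<rho> a z r' \<epsilon>' c'" "0 < a"
  shows "r = r'"
proof -
  have False if adm': "admissible \<rho> a z r \<epsilon> c" "admissible \<rho> a z r' \<epsilon>' c'" and "r < r'" for r r' \<epsilon> \<epsilon>' c c'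
  proof -
    have pos: "1 < r" using admissible_pos[OF adm'(1)] by simp
    have "1 / r \<in> {1 / r'<..1}" using pos \<open>r < r'\<close> by (auto simp: field_simps)
    then have "z (1 / r) \<le> a / r'" using adm'(2) unfolding admissible_def by blast
    moreover have "a / r' < a / r" using pos \<open>r < r'\<close> \<open>0 < a\<close> by (simp add: frac_less2)
    ultimately show False using admissible_value[OF adm'(1)] by simp
  qed
  with assms show ?thesis by (meson linorder_neqE)
qed

section \<open>The limit of the integral over W\<close>

text \<open>The maximum is the falling line on the negative half-axis and the rising one on the
  positive half-axis, so the integral splits into two exponential integrals.\<close>

lemma integral_exp_neg_max:
  fixes \<alpha> \<beta> :: real
  assumes "0 < \<alpha>" "0 < \<beta>"
  shows "(LINT t|lborel. exp (- max (- \<alpha> * t) (\<beta> * t))) = 1 / \<alpha> + 1 / \<beta>"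
proof -
  have half: "has_bochner_integral lborel (\<lambda>t. indicator {0<..} t *\<^sub>R exp (- (t * u))) (1 / u)" if "0 < u" for u :: real
    using integrable_I0i_exp_mscale[OF that] LBINT_I0i_exp_mscale[OF that]
    by (simp add: has_bochner_integral_iff set_integrable_def set_lebesgue_integral_def interval_lebesgue_integral_0_infty)
  have "has_bochner_integral lborel (\<lambda>t. indicator {0<..} (- t) *\<^sub>R exp (- (- t * \<alpha>))) (1 / \<alpha>)"
    using half[OF assms(1)] lborel_has_bochner_integral_real_affine_iff[of "- 1" "\<lambda>t. indicator {0<..} t *\<^sub>R exp (- (t * \<alpha>))" "1 / \<alpha>" 0]
    by simp
  from has_bochner_integral_add[OF this half[OF assms(2)]]
  have *: "has_bochner_integral lborel (\<lambda>t. indicator {0<..} (- t) *\<^sub>R exp (- (- t * \<alpha>)) + indicator {0<..} t *\<^sub>R exp (- (t * \<beta>))) (1 / \<alpha> + 1 / \<beta>)" .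
  \<comment> \<open>At 0 both indicators vanish while the integrand is 1, so the identity holds only
    almost everywhere.\<close>
  have "AE t in lborel. t \<noteq> (0::real)" by (rule AE_lborel_singleton)
  then have ae: "AE t in lborel. indicator {0<..} (- t) *\<^sub>R exp (- (- t * \<alpha>)) + indicator {0<..} t *\<^sub>R exp (- (t * \<beta>)) = exp (- max (- \<alpha> * t) (\<beta> * t))"
  proof eventually_elim
    case (elim t)
    show ?case
    proof (cases "0 < t")
      case True
      then have "- \<alpha> * t < 0" "0 < \<beta> * t" using assms by (simp_all add: mult_neg_pos)
      then have "max (- \<alpha> * t) (\<beta> * t) = \<beta> * t" by linarith
      with True show ?thesis by (simp add: mult.commute)
    next
      case False
      with elim have "t < 0" by simp
      then have "0 < - \<alpha> * t" "\<beta> * t < 0" using assms by (simp_all add: mult_pos_neg)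
      then have "max (- \<alpha> * t) (\<beta> * t) = - \<alpha> * t" by linarith
      with \<open>t < 0\<close> show ?thesis by (simp add: mult.commute)
    qed
  qed
  from * have "has_bochner_integral lborel (\<lambda>t. exp (- max (- \<alpha> * t) (\<beta> * t))) (1 / \<alpha> + 1 / \<beta>)"
    by (rule has_bochner_integral_cong_AE[OF _ _ ae, THEN iffD1, rotated 2]) measurable
  then show ?thesis
    by (rule has_bochner_integral_integral_eq)
qed

text \<open>The two lines cross at \<open>t0\<close> at the common height \<open>m\<close>.
  Translating by \<open>t0\<close> reduces to \<open>integral_exp_neg_max\<close>; the height gives
  the exponential factor of the final formula.\<close>

lemma integral_exp_neg_max_shift:
  fixes \<alpha> k p q :: real
  assumes "0 < \<alpha>" "0 < k"
  shows "(LINT t|lborel. exp (- max (p - \<alpha> * t) (q + \<alpha> * t / k))) =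
    (k + 1) / \<alpha> * exp (- ((k * q + p) / (k + 1)))"
proof -
  define m where "m = (k * q + p) / (k + 1)"
  define t0 where "t0 = k * (p - q) / (\<alpha> * (k + 1))"
  have t0: "\<alpha> * t0 = k * (p - q) / (k + 1)" using assms by (simp add: t0_def)
  have k1: "k + 1 \<noteq> 0" using assms by simp
  have "m + \<alpha> * t0 = p * (k + 1) / (k + 1)"
    unfolding m_def t0 add_divide_distrib[symmetric] by (simp add: algebra_simps)
  also have "\<dots> = p" by (rule nonzero_mult_div_cancel_right[OF k1])
  finally have e1: "p - \<alpha> * (t0 + 1 * t) = m + - \<alpha> * t" for t
    by (simp add: algebra_simps)
  have "\<alpha> * t0 / k = (p - q) / (k + 1)" using assms unfolding t0 by simp
  moreover have "m - (p - q) / (k + 1) = q * (k + 1) / (k + 1)"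
    unfolding m_def diff_divide_distrib[symmetric] by (simp add: algebra_simps)
  moreover have "q * (k + 1) / (k + 1) = q" by (rule nonzero_mult_div_cancel_right[OF k1])
  ultimately have e2: "q + \<alpha> * (t0 + 1 * t) / k = m + \<alpha> / k * t" for t
    by (simp add: distrib_left add_divide_distrib)
  have "(LINT t|lborel. exp (- max (p - \<alpha> * t) (q + \<alpha> * t / k))) =
      (LINT t|lborel. exp (- max (p - \<alpha> * (t0 + 1 * t)) (q + \<alpha> * (t0 + 1 * t) / k)))"
    by (subst lborel_integral_real_affine[of 1 _ t0]) auto
  also have "\<dots> = (LINT t|lborel. exp (- m) * exp (- max (- \<alpha> * t) (\<alpha> / k * t)))"
    unfolding e1 e2 max_add_distrib_right[symmetric] by (simp only: minus_add_distrib exp_add)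
  also have "\<dots> = exp (- m) * (1 / \<alpha> + 1 / (\<alpha> / k))"
    using integral_exp_neg_max[of \<alpha> "\<alpha> / k"] assms by simp
  also have "\<dots> = (k + 1) / \<alpha> * exp (- m)"
    using assms by (simp add: field_simps)
  finally show ?thesis by (simp add: m_def)
qed

section \<open>Localisation at the crossing point and dominated convergence\<close>

lemma integrable_const_inverse_1_plus_square:
  "integrable lborel (\<lambda>t::real. C * inverse (1 + t\<^sup>2))"
  using integrable_inverse_1_plus_square
  by (intro integrable_mult_right) (simp add: set_integrable_def)

text \<open>The conditional tail given W = s: for positive x and y it is the probability that R s >
  x and R z(s) > y. A positive R cannot satisfy both unless s and z(s) are positive, whence the
  value 0 otherwise.\<close>

definition section_tail :: "(real \<Rightarrow> real) \<Rightarrow> (real \<Rightarrow> real) \<Rightarrow> real \<Rightarrow> real \<Rightarrow> real \<Rightarrow> real" where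
  "section_tail T z x y s = (if 0 < s \<and> 0 < z s then T (max (x / s) (y / z s)) else 0)"

text \<open>The thresholds b y / s and a b y / z(s) cross at s = b at height y, the first falling
  and the second rising there. \<open>z_away\<close> keeps the second one away from y on the right
  of b; on the left the first one is already large, so no condition on z is imposed there.\<close>

locale ray_crossing = gumbel_tail T w for T w :: "real \<Rightarrow> real" +
  fixes h z :: "real \<Rightarrow> real" and a b c :: real
  assumes tail_le_1: "\<And>x. T x \<le> 1"
    and b: "0 < b" "b < 1" and a: "0 < a" and c: "0 < c"
    and z_meas [measurable]: "z \<in> borel_measurable borel"
    and h_nonneg: "\<And>s. 0 \<le> h s" and h_int: "integrable lborel h" and h_mass: "(LINT s|lborel. h s) = 1"
    and h_supp: "\<And>s. s \<notin> {0<..<1} \<Longrightarrow> h s = 0"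
    and h_cont: "isCont h b"
    and z_b: "z b = a * b" and z_deriv: "(z has_real_derivative - (1 / c)) (at b)"
    and z_away: "\<And>u. 0 < u \<Longrightarrow> \<exists>\<kappa><a * b. \<forall>s\<in>{b + u..1}. z s \<le> \<kappa>"
begin

lemma h_meas [measurable]: "h \<in> borel_measurable borel"
  using h_int by auto

lemma T_meas [measurable]: "T \<in> borel_measurable borel"
proof -
  have "(\<lambda>x. - T x) \<in> borel_measurable borel"
    by (rule borel_measurable_mono) (auto simp: mono_def tail_le)
  then show ?thesis by simp
qed

lemma section_tail_meas [measurable]: "section_tail T z x y \<in> borel_measurable borel"
  unfolding section_tail_def by measurable

lemma section_tail_bounds: "0 \<le> section_tail T z x y s" "section_tail T z x y s \<le> 1"
  using tail_pos tail_le_1 by (auto simp: section_tail_def less_imp_le)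

lemma section_tail_le:
  assumes "0 < s \<Longrightarrow> 0 < z s \<Longrightarrow> B \<le> x / s \<or> B \<le> y / z s"
  shows "section_tail T z x y s \<le> T B"
  using assms tail_pos[of B] unfolding section_tail_def by (auto intro!: tail_le simp: le_max_iff_disj)

text \<open>Half of the slope 1/c is given up to absorb the error of the linearisation.\<close>

lemma z_local_bound: "\<exists>u0>0. \<forall>u. 0 < u \<longrightarrow> u < u0 \<longrightarrow> z (b + u) \<le> a * b - u / (2 * c)"
proof -
  have "((\<lambda>u. (z (b + u) - z b) / u) \<longlongrightarrow> - (1 / c)) (at_right 0)"
    using z_deriv unfolding DERIV_def by (rule filterlim_mono[OF _ order_refl at_le]) simp
  then have "\<forall>\<^sub>F u in at_right 0. (z (b + u) - z b) / u < - (1 / (2 * c))"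
    by (rule order_tendstoD) (use c in \<open>simp add: field_simps\<close>)
  then obtain u0 where u0: "u0 > 0" "\<And>u. 0 < u \<Longrightarrow> u < u0 \<Longrightarrow> (z (b + u) - z b) / u < - (1 / (2 * c))"
    unfolding eventually_at_right_field by auto
  have "z (b + u) \<le> a * b - u / (2 * c)" if "0 < u" "u < u0" for u
  proof -
    have "z (b + u) - z b < - (1 / (2 * c)) * u"
      using u0(2)[OF that] that by (simp only: divide_less_eq if_True)
    then show ?thesis using z_b by simp
  qed
  with u0(1) show ?thesis by blast
qed

text \<open>To the left of the neighbourhood x1 / s exceeds y by the factor b / (b - u0), to the
  right y1 / z(s) does so by a b / \<kappa>. Either way R > k y with a fixed k > 1, and
  \<open>tail_dilation_negligible\<close> applies since \<open>h\<close> has mass 1.\<close>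

lemma far_negligible:
  fixes y x1 y1 :: "nat \<Rightarrow> real"
  assumes u0: "0 < u0" "u0 < b" and y: "filterlim y at_top sequentially"
    and x1: "\<forall>\<^sub>F n in sequentially. b * y n \<le> x1 n" and y1: "\<forall>\<^sub>F n in sequentially. a * b * y n \<le> y1 n"
  shows "(\<lambda>n. y n * w (y n) / T (y n) * (LINT s|lborel. indicator (- {b - u0<..<b + u0}) s * (h s * section_tail T z (x1 n) (y1 n) s))) \<longlonglongrightarrow> 0"
proof -
  obtain \<kappa>0 where \<kappa>0: "\<kappa>0 < a * b" "\<forall>s\<in>{b + u0..1}. z s \<le> \<kappa>0" using z_away[OF u0(1)] by blast
  \<comment> \<open>The bound from \<open>z_away\<close> may be nonpositive. Raising it to at least
    a b / 2 makes the quotient a b / \<kappa> meaningful while \<kappa> stays below a b.\<close>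
  define \<kappa> where "\<kappa> = max \<kappa>0 (a * b / 2)"
  have ab: "0 < a * b" using a b by simp
  have \<kappa>: "0 < \<kappa>" "\<kappa> < a * b" "\<And>s. s \<in> {b + u0..1} \<Longrightarrow> z s \<le> \<kappa>"
    using \<kappa>0 ab by (auto simp: \<kappa>_def le_max_iff_disj)
  define k where "k = min (b / (b - u0)) (a * b / \<kappa>)"
  have k1: "1 < k" using u0 \<kappa> unfolding k_def by (simp add: field_simps)
  have bnd: "\<forall>\<^sub>F n in sequentially. \<forall>s. indicator (- {b - u0<..<b + u0}) s * (h s * section_tail T z (x1 n) (y1 n) s) \<le> h s * T (k * y n)"
    using x1 y1 filterlim_at_top_dense[THEN iffD1, OF y, rule_format, of 0]
  proof eventually_elim
    case (elim n)
    show ?case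
    proof
      fix s
      show "indicator (- {b - u0<..<b + u0}) s * (h s * section_tail T z (x1 n) (y1 n) s) \<le> h s * T (k * y n)"
      proof (cases "s \<in> {0<..<1} - {b - u0<..<b + u0}")
        case True
        have "section_tail T z (x1 n) (y1 n) s \<le> T (k * y n)"
        proof (rule section_tail_le)
          assume s: "0 < s" "0 < z s"
          show "k * y n \<le> x1 n / s \<or> k * y n \<le> y1 n / z s"
          proof (cases "s \<le> b - u0")
            case True
            have "k * y n \<le> b / (b - u0) * y n" using elim by (intro mult_right_mono) (auto simp: k_def)
            also have "\<dots> = b * y n / (b - u0)" by simp
            also have "\<dots> \<le> x1 n / s"
              using True s elim b by (intro frac_le) (auto simp: less_imp_le intro: mult_nonneg_nonneg order_trans[of 0 "b * y n"])
            finally show ?thesis ..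
          next
            case False
            then have "s \<in> {b + u0..1}" using \<open>s \<in> {0<..<1} - {b - u0<..<b + u0}\<close> by auto
            from \<kappa>(3)[OF this] have zs: "z s \<le> \<kappa>" .
            have "k * y n \<le> a * b / \<kappa> * y n" using elim by (intro mult_right_mono) (auto simp: k_def)
            also have "\<dots> = a * b * y n / \<kappa>" by simp
            also have "\<dots> \<le> y1 n / z s"
              using zs s elim ab by (intro frac_le) (auto simp: less_imp_le intro: mult_nonneg_nonneg order_trans[of 0 "a * b * y n"])
            finally show ?thesis ..
          qed
        qed
        then show ?thesis using True h_nonneg[of s] by (simp add: mult_left_mono)
      next
        case False
        then have "h s = 0 \<or> s \<in> {b - u0<..<b + u0}" using h_supp by blast
        then show ?thesis using h_nonneg[of s] tail_pos[of "k * y n"] by auto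
      qed
    qed
  qed
  show ?thesis
  proof (rule tendsto_sandwich[OF _ _ tendsto_const])
    show "(\<lambda>n. y n * w (y n) * T (k * y n) / T (y n)) \<longlonglongrightarrow> 0"
      using filterlim_compose[OF tail_dilation_negligible[OF k1] y] .
    show "\<forall>\<^sub>F n in sequentially. 0 \<le> y n * w (y n) / T (y n) * (LINT s|lborel. indicator (- {b - u0<..<b + u0}) s * (h s * section_tail T z (x1 n) (y1 n) s))"
      using filterlim_at_top_dense[THEN iffD1, OF y, rule_format, of 0]
    proof eventually_elim
      case (elim n)
      show ?case
        by (intro mult_nonneg_nonneg divide_nonneg_nonneg integral_nonneg_AE AE_I2)
           (use elim scaling_pos[of "y n"] tail_pos[of "y n"] h_nonneg section_tail_bounds in auto)
    qed
    show "\<forall>\<^sub>F n in sequentially. y n * w (y n) / T (y n) * (LINT s|lborel. indicator (- {b - u0<..<b + u0}) s * (h s * section_tail T z (x1 n) (y1 n) s))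
        \<le> y n * w (y n) * T (k * y n) / T (y n)"
      using bnd filterlim_at_top_dense[THEN iffD1, OF y, rule_format, of 0]
    proof eventually_elim
      case (elim n)
      have "(LINT s|lborel. indicator (- {b - u0<..<b + u0}) s * (h s * section_tail T z (x1 n) (y1 n) s)) \<le> (LINT s|lborel. h s * T (k * y n))"
      proof (rule integral_mono')
        show "integrable lborel (\<lambda>s. h s * T (k * y n))" using h_int by simp
      qed (use elim(1) h_nonneg tail_pos[of "k * y n"] in \<open>auto intro!: mult_nonneg_nonneg simp: less_imp_le\<close>)
      also have "\<dots> = T (k * y n)" by (simp add: h_mass)
      finally have "y n * w (y n) / T (y n) * (LINT s|lborel. indicator (- {b - u0<..<b + u0}) s * (h s * section_tail T z (x1 n) (y1 n) s)) \<le> y n * w (y n) / T (y n) * T (k * y n)"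
        by (rule mult_left_mono) (use elim(2) scaling_pos[of "y n"] tail_pos[of "y n"] in auto)
      then show ?case by simp
    qed
  qed
qed

text \<open>On the scale s = b + t / v both thresholds differ from y by a convergent multiple of 1 /
  w y, so \<open>tail_ratio_moving\<close> gives the limit. The derivative of z enters through the
  second multiple.\<close>

lemma section_tail_pointwise:
  fixes y p q :: "nat \<Rightarrow> real" and t \<delta> \<eta> :: real
  defines "v \<equiv> \<lambda>n. y n * w (y n)"
  assumes y: "filterlim y at_top sequentially" and p: "p \<longlonglongrightarrow> \<delta>" and q: "q \<longlonglongrightarrow> \<eta>"
  shows "(\<lambda>n. section_tail T z (b * y n * (1 + p n / v n)) (a * b * y n * (1 + q n / v n)) (b + t / v n) / T (y n))
    \<longlonglongrightarrow> exp (- max (\<delta> - t / b) (\<eta> + t / b / (c * a)))"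
proof -
  have v: "filterlim v at_top sequentially"
    unfolding v_def by (rule filterlim_compose[OF scaled_at_top y])
  have ab: "0 < a * b" using a b by simp
  define s where "s n = b + t / v n" for n
  have tv: "(\<lambda>n. t / v n) \<longlonglongrightarrow> 0"
    by (rule tendsto_divide_0[OF tendsto_const filterlim_at_top_imp_at_infinity[OF v]])
  have s_lim: "s \<longlonglongrightarrow> b" using tendsto_add[OF tendsto_const[of b] tv] by (simp add: s_def[abs_def])
  have zs_lim: "(\<lambda>n. z (s n)) \<longlonglongrightarrow> a * b"
    using isCont_tendsto_compose[OF DERIV_isCont[OF z_deriv] s_lim] by (simp add: z_b)
  have pos: "\<forall>\<^sub>F n in sequentially. 0 < y n \<and> 0 < v n \<and> 0 < s n \<and> 0 < z (s n)"
    using y v order_tendstoD(1)[OF s_lim b(1)] order_tendstoD(1)[OF zs_lim ab]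
    by (auto simp: filterlim_at_top_dense intro!: eventually_conj)
  \<comment> \<open>This is differentiability at b along the increments t / v. The case t = 0 is
    separate because the difference quotient needs nonzero increments.\<close>
  have incr: "(\<lambda>n. v n * (z (s n) - a * b)) \<longlonglongrightarrow> - (t / c)"
  proof (cases "t = 0")
    case True
    then show ?thesis by (simp add: s_def z_b)
  next
    case False
    have "\<forall>\<^sub>F n in sequentially. t / v n \<noteq> 0"
      using pos by eventually_elim (use False in simp)
    then have "filterlim (\<lambda>n. t / v n) (at 0) sequentially"
      using tv by (simp add: filterlim_at)
    from filterlim_compose[OF z_deriv[unfolded DERIV_def] this]
    have "(\<lambda>n. t * ((z (s n) - z b) / (t / v n))) \<longlonglongrightarrow> t * - (1 / c)"
      unfolding s_def by (rule tendsto_mult[OF tendsto_const])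
    then show ?thesis using False by (simp add: z_b mult.commute)
  qed
  \<comment> \<open>\<open>\<tau>1 n\<close> and \<open>\<tau>2 n\<close> solve x1 / s = y + \<tau>1
    / w y and y1 / z(s) = y + \<tau>2 / w y, using 1 / w y = y / v.\<close>
  define \<tau>1 where "\<tau>1 n = (b * p n - t) / s n" for n
  define \<tau>2 where "\<tau>2 n = (a * b * q n - v n * (z (s n) - a * b)) / z (s n)" for n
  have "\<tau>1 \<longlonglongrightarrow> (b * \<delta> - t) / b"
    unfolding \<tau>1_def[abs_def] by (intro tendsto_intros p s_lim) (use b in simp)
  moreover have "\<tau>2 \<longlonglongrightarrow> (a * b * \<eta> - - (t / c)) / (a * b)"
    unfolding \<tau>2_def[abs_def] by (intro tendsto_divide tendsto_diff tendsto_mult tendsto_const q incr zs_lim) (use a b in simp)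
  moreover have "(b * \<delta> - t) / b = \<delta> - t / b" using b by (simp add: field_simps)
  moreover have "(a * b * \<eta> - - (t / c)) / (a * b) = \<eta> + t / b / (c * a)"
    using a b c by (simp add: field_simps)
  ultimately have "(\<lambda>n. max (\<tau>1 n) (\<tau>2 n)) \<longlonglongrightarrow> max (\<delta> - t / b) (\<eta> + t / b / (c * a))"
    using tendsto_max[of \<tau>1 _ _ \<tau>2] by simp
  from tail_ratio_moving[OF y this]
  show ?thesis
  proof (rule tendsto_cong[THEN iffD1, rotated])
    show "\<forall>\<^sub>F n in sequentially. T (y n + max (\<tau>1 n) (\<tau>2 n) / w (y n)) / T (y n) =
      section_tail T z (b * y n * (1 + p n / v n)) (a * b * y n * (1 + q n / v n)) (b + t / v n) / T (y n)"
      using pos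
    proof eventually_elim
      case (elim n)
      have w: "0 < w (y n)" using elim by (intro scaling_pos) simp
      have inv: "1 / w (y n) = y n / v n" using elim w by (simp add: v_def)
      have "(y n + \<tau>1 n / w (y n)) * s n = b * y n * (1 + p n / v n)"
      proof -
        have "(y n + \<tau>1 n / w (y n)) * s n = y n * s n + (\<tau>1 n * s n) * (1 / w (y n))"
          by (simp add: algebra_simps)
        also have "\<tau>1 n * s n = b * p n - t" using elim by (simp add: \<tau>1_def)
        also have "y n * s n + (b * p n - t) * (1 / w (y n)) = b * y n * (1 + p n / v n)"
          unfolding inv s_def by (simp add: algebra_simps)
        finally show ?thesis .
      qed
      then have 1: "b * y n * (1 + p n / v n) / s n = y n + \<tau>1 n / w (y n)"
        using elim by (metis less_irrefl nonzero_eq_divide_eq)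
      have "(y n + \<tau>2 n / w (y n)) * z (s n) = a * b * y n * (1 + q n / v n)"
      proof -
        have "(y n + \<tau>2 n / w (y n)) * z (s n) = y n * z (s n) + (\<tau>2 n * z (s n)) * (1 / w (y n))"
          by (simp add: algebra_simps)
        also have "\<tau>2 n * z (s n) = a * b * q n - v n * (z (s n) - a * b)" using elim by (simp add: \<tau>2_def)
        also have "y n * z (s n) + (a * b * q n - v n * (z (s n) - a * b)) * (1 / w (y n)) = a * b * y n * (1 + q n / v n)"
          unfolding inv using elim by (simp add: field_simps)
        finally show ?thesis .
      qed
      then have 2: "a * b * y n * (1 + q n / v n) / z (s n) = y n + \<tau>2 n / w (y n)"
        using elim by (metis less_irrefl nonzero_eq_divide_eq)
      have "max (y n + \<tau>1 n / w (y n)) (y n + \<tau>2 n / w (y n)) = y n + max (\<tau>1 n) (\<tau>2 n) / w (y n)"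
        using w by (simp add: max_def divide_right_mono) (auto simp: divide_le_cancel)
      then show ?case
        using elim 1 2 unfolding section_tail_def s_def[symmetric] by simp
    qed
  qed
qed

text \<open>Near b the larger threshold is at least y + \<beta> |t| / w y, so
  \<open>tail_bound\<close> yields a majorant of order 1 / (1 + t^2), while \<open>h\<close> is
  bounded there by continuity. The estimate is uniform in x1 and y1, as these enter only through
  their lower bounds.\<close>

lemma section_tail_dominated:
  "\<exists>u0 C. 0 < u0 \<and> u0 < b \<and> 0 \<le> C \<and> (\<forall>\<^sub>F y in at_top. \<forall>x1 y1 t. b * y \<le> x1 \<longrightarrow> a * b * y \<le> y1 \<longrightarrow> b + t / (y * w y) \<in> {b - u0<..<b + u0} \<longrightarrow>
     h (b + t / (y * w y)) * section_tail T z x1 y1 (b + t / (y * w y)) \<le> C * inverse (1 + t\<^sup>2) * T y)"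
proof -
  have ab: "0 < a * b" using a b by simp
  obtain u1 where u1: "u1 > 0" "\<And>u. 0 < u \<Longrightarrow> u < u1 \<Longrightarrow> z (b + u) \<le> a * b - u / (2 * c)"
    using z_local_bound by blast
  obtain u2 where u2: "u2 > 0" "\<And>s. \<bar>s - b\<bar> < u2 \<Longrightarrow> h s \<le> h b + 1"
  proof -
    have "\<forall>\<^sub>F s in nhds b. h s < h b + 1"
      using h_cont by (intro order_tendstoD(2)) (auto simp: isCont_def tendsto_at_iff_tendsto_nhds)
    then show ?thesis unfolding eventually_nhds_metric dist_real_def by (metis less_imp_le that)
  qed
  define u0 where "u0 = min (b / 2) (min u1 u2)"
  have u0: "0 < u0" "u0 < b" "u0 \<le> u1" "u0 \<le> u2" using u1 u2 b by (auto simp: u0_def)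
  \<comment> \<open>The smaller of two slopes: 1/b from x1 / s for t \<le> 0, and 1 / (2 c a b) from
    y1 / z(s) for t > 0, the latter halved by \<open>z_local_bound\<close>.\<close>
  define \<beta> where "\<beta> = min (1 / b) (1 / (2 * c * a * b))"
  have \<beta>: "0 < \<beta>" "\<beta> \<le> 1 / b" "\<beta> \<le> 1 / (2 * c * a * b)" using a b c by (auto simp: \<beta>_def)
  \<comment> \<open>Chosen so that m (1 + t^2) \<le> 4 + \<beta>^2 t^2 \<le> (\<beta> |t| +
    2)^2.\<close>
  define m where "m = min (\<beta>\<^sup>2) 4"
  have m: "0 < m" "m \<le> \<beta>\<^sup>2" "m \<le> 4" using \<beta> by (auto simp: m_def)
  define C where "C = (h b + 1) * (9 / m)"
  have "0 \<le> C" using h_nonneg[of b] m by (simp add: C_def)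
  moreover have "\<forall>\<^sub>F y in at_top. \<forall>x1 y1 t. b * y \<le> x1 \<longrightarrow> a * b * y \<le> y1 \<longrightarrow> b + t / (y * w y) \<in> {b - u0<..<b + u0} \<longrightarrow>
     h (b + t / (y * w y)) * section_tail T z x1 y1 (b + t / (y * w y)) \<le> C * inverse (1 + t\<^sup>2) * T y"
    using tail_bound eventually_gt_at_top[of 0]
  proof eventually_elim
    case (elim y)
    have w: "0 < w y" using elim by (intro scaling_pos)
    define v where "v = y * w y"
    have v: "0 < v" using elim w by (simp add: v_def)
    have yw: "y * (1 + e / v) = y + e / w y" for e
      using elim w by (simp add: v_def field_simps)
    show ?case unfolding v_def[symmetric]
    proof (intro allI impI)
      fix x1 y1 t
      assume x1: "b * y \<le> x1" and y1: "a * b * y \<le> y1" and t: "b + t / v \<in> {b - u0<..<b + u0}"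
      have "section_tail T z x1 y1 (b + t / v) \<le> T (y + \<beta> * \<bar>t\<bar> / w y)"
      proof (rule section_tail_le)
        assume s: "0 < b + t / v" "0 < z (b + t / v)"
        show "y + \<beta> * \<bar>t\<bar> / w y \<le> x1 / (b + t / v) \<or> y + \<beta> * \<bar>t\<bar> / w y \<le> y1 / z (b + t / v)"
        proof (cases "t \<le> 0")
          case True
          \<comment> \<open>With A = |t| / (b v) this is (1 + A)(1 - A) \<le> 1, which bounds 1 / (1
            - A) below by 1 + A. The case of positive t uses the same inequality with its own
            A.\<close>
          have "(1 + 1 / b * \<bar>t\<bar> / v) * (b + t / v) = b * (1 - (t / b / v)\<^sup>2)"
            using True b v by (simp add: field_simps power2_eq_square)
          also have "\<dots> \<le> b" using b by (simp add: algebra_simps)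
          finally have *: "1 + 1 / b * \<bar>t\<bar> / v \<le> b / (b + t / v)"
            using s by (simp add: pos_le_divide_eq)
          have "y + \<beta> * \<bar>t\<bar> / w y = y * (1 + \<beta> * \<bar>t\<bar> / v)" by (simp add: yw)
          also have "\<dots> \<le> y * (1 + 1 / b * \<bar>t\<bar> / v)"
            using \<beta>(2) elim v by (intro mult_left_mono add_left_mono divide_right_mono mult_right_mono) auto
          also have "\<dots> \<le> y * (b / (b + t / v))" using * elim by (intro mult_left_mono) auto
          also have "\<dots> = b * y / (b + t / v)" by simp
          also have "\<dots> \<le> x1 / (b + t / v)" using x1 s by (intro divide_right_mono) auto
          finally show ?thesis ..
        next
          case False
          define A where "A = 1 / (2 * c * a * b) * \<bar>t\<bar> / v"
          have "0 < t / v" "t / v < u1" using False v t u0 by auto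
          from u1(2)[OF this] have "z (b + t / v) \<le> a * b - t / v / (2 * c)" .
          also have "\<dots> = a * b * (1 - A)" using False a b c v by (simp add: A_def field_simps)
          finally have zs: "z (b + t / v) \<le> a * b * (1 - A)" .
          have A: "0 \<le> A" using a b c v by (simp add: A_def)
          have "(1 + A) * z (b + t / v) \<le> (1 + A) * (a * b * (1 - A))"
            using zs A by (intro mult_left_mono) auto
          also have "\<dots> = a * b * (1 - A\<^sup>2)" by (simp add: power2_eq_square algebra_simps)
          also have "\<dots> \<le> a * b" using mult_left_mono[of "1 - A\<^sup>2" 1 "a * b"] ab by simp
          finally have *: "1 + A \<le> a * b / z (b + t / v)"
            using s by (simp add: pos_le_divide_eq)
          have "y + \<beta> * \<bar>t\<bar> / w y = y * (1 + \<beta> * \<bar>t\<bar> / v)" by (simp add: yw)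
          also have "\<dots> \<le> y * (1 + A)" unfolding A_def
            using \<beta>(3) elim v by (intro mult_left_mono add_left_mono divide_right_mono mult_right_mono) auto
          also have "\<dots> \<le> y * (a * b / z (b + t / v))" using * elim by (intro mult_left_mono) auto
          also have "\<dots> = a * b * y / z (b + t / v)" by simp
          also have "\<dots> \<le> y1 / z (b + t / v)" using y1 s by (intro divide_right_mono) auto
          finally show ?thesis ..
        qed
      qed
      also have "\<dots> \<le> 9 / (\<beta> * \<bar>t\<bar> + 2)\<^sup>2 * T y" using elim(1) \<beta>(1) by simp
      also have "\<dots> \<le> 9 / m * inverse (1 + t\<^sup>2) * T y"
      proof (rule mult_right_mono)
        have pos: "0 < \<beta> * \<bar>t\<bar> + 2" "0 < 1 + t\<^sup>2"
          using \<beta>(1) by (simp_all add: add_nonneg_pos add_pos_nonneg)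
        have "m * (1 + t\<^sup>2) = m + m * t\<^sup>2" by (simp add: algebra_simps)
        also have "\<dots> \<le> 4 + \<beta>\<^sup>2 * t\<^sup>2" using m by (intro add_mono mult_right_mono) auto
        also have "\<dots> \<le> (\<beta> * \<bar>t\<bar> + 2)\<^sup>2"
          using \<beta> by (simp add: power2_sum power_mult_distrib)
        finally have "9 / (\<beta> * \<bar>t\<bar> + 2)\<^sup>2 \<le> 9 / (m * (1 + t\<^sup>2))"
          using m pos by (intro divide_left_mono mult_pos_pos zero_less_power) auto
        then show "9 / (\<beta> * \<bar>t\<bar> + 2)\<^sup>2 \<le> 9 / m * inverse (1 + t\<^sup>2)" by (simp add: divide_inverse)
      qed (use tail_pos[of y] in simp)
      finally have st: "section_tail T z x1 y1 (b + t / v) \<le> 9 / m * inverse (1 + t\<^sup>2) * T y" .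
      have "h (b + t / v) \<le> h b + 1" using t u0 by (intro u2(2)) auto
      then have "h (b + t / v) * section_tail T z x1 y1 (b + t / v) \<le> (h b + 1) * (9 / m * inverse (1 + t\<^sup>2) * T y)"
        using st h_nonneg[of b] section_tail_bounds by (intro mult_mono) auto
      then show "h (b + t / v) * section_tail T z x1 y1 (b + t / v) \<le> C * inverse (1 + t\<^sup>2) * T y"
        unfolding C_def by (simp only: mult_ac)
    qed
  qed
  ultimately show ?thesis using u0 by blast
qed

text \<open>Outside the neighbourhood \<open>S\<close> the integral is negligible. Inside, the
  substitution s = b + t / v has Jacobian 1 / v, which cancels the factor v and leaves the integral
  of \<open>g n\<close>, to which dominated convergence applies. Nonnegative \<open>p\<close> and
  \<open>q\<close> keep the thresholds above b y and a b y, as both estimates require.\<close>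

lemma ray_crossing_limit:
  fixes y p q :: "nat \<Rightarrow> real"
  defines "v \<equiv> \<lambda>n. y n * w (y n)"
  assumes y: "filterlim y at_top sequentially" and p: "p \<longlonglongrightarrow> \<delta>" and q: "q \<longlonglongrightarrow> \<eta>"
    and p_nonneg: "\<And>n. 0 \<le> p n" and q_nonneg: "\<And>n. 0 \<le> q n"
  shows "(\<lambda>n. v n / T (y n) * (LINT s|lborel. h s *
      section_tail T z (b * y n * (1 + p n / v n)) (a * b * y n * (1 + q n / v n)) s))
    \<longlonglongrightarrow> h b * (b * (c * a + 1) * exp (- ((c * a * \<eta> + \<delta>) / (c * a + 1))))"
proof -
  have v: "filterlim v at_top sequentially"
    unfolding v_def by (rule filterlim_compose[OF scaled_at_top y])
  obtain u0 C where u0: "0 < u0" "u0 < b" and C: "0 \<le> C" and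
    dom: "\<forall>\<^sub>F y in at_top. \<forall>x1 y1 t. b * y \<le> x1 \<longrightarrow> a * b * y \<le> y1 \<longrightarrow> b + t / (y * w y) \<in> {b - u0<..<b + u0} \<longrightarrow>
     h (b + t / (y * w y)) * section_tail T z x1 y1 (b + t / (y * w y)) \<le> C * inverse (1 + t\<^sup>2) * T y"
    using section_tail_dominated by blast
  define S where "S = {b - u0<..<b + u0}"
  have S_meas [measurable]: "S \<in> sets borel" by (simp add: S_def)
  define x1 where "x1 n = b * y n * (1 + p n / v n)" for n
  define y1 where "y1 n = a * b * y n * (1 + q n / v n)" for n
  define f where "f n s = h s * section_tail T z (x1 n) (y1 n) s" for n s
  have f_meas [measurable]: "f n \<in> borel_measurable borel" for n
    unfolding f_def by measurable
  have f_int: "integrable lborel (f n)" for n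
    by (rule Bochner_Integration.integrable_bound[OF h_int])
       (use h_nonneg section_tail_bounds in \<open>auto simp: f_def abs_mult intro!: mult_left_le\<close>)
  have f_int_ind: "integrable lborel (\<lambda>s. indicator A s * f n s)" if "A \<in> sets borel" for A n
    using integrable_mult_indicator[OF _ f_int, of A] that by simp
  have split: "(LINT s|lborel. f n s) = (LINT s|lborel. indicator S s * f n s) + (LINT s|lborel. indicator (- S) s * f n s)" for n
  proof -
    have "(LINT s|lborel. f n s) = (LINT s|lborel. indicator S s * f n s + indicator (- S) s * f n s)"
      by (intro Bochner_Integration.integral_cong) (auto split: split_indicator)
    also have "\<dots> = (LINT s|lborel. indicator S s * f n s) + (LINT s|lborel. indicator (- S) s * f n s)"
      by (intro Bochner_Integration.integral_add f_int_ind) auto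
    finally show ?thesis .
  qed
  have pos: "\<forall>\<^sub>F n in sequentially. 0 < y n \<and> 0 < v n"
    using y v by (auto simp: filterlim_at_top_dense intro!: eventually_conj)
  have xy1: "\<forall>\<^sub>F n in sequentially. b * y n \<le> x1 n \<and> a * b * y n \<le> y1 n"
    using pos
  proof eventually_elim
    case (elim n)
    have "b * y n * 1 \<le> x1 n" unfolding x1_def
      using elim p_nonneg[of n] b by (intro mult_left_mono) auto
    moreover have "a * b * y n * 1 \<le> y1 n" unfolding y1_def
      using elim q_nonneg[of n] a b by (intro mult_left_mono) auto
    ultimately show ?case by simp
  qed
  have far: "(\<lambda>n. v n / T (y n) * (LINT s|lborel. indicator (- S) s * f n s)) \<longlonglongrightarrow> 0"
    unfolding S_def v_def f_def
    by (rule far_negligible[OF u0 y]) (use xy1 in \<open>auto elim: eventually_mono\<close>)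
  define g where "g n t = indicator S (b + t / v n) * f n (b + t / v n) / T (y n)" for n t
  have g_meas [measurable]: "g n \<in> borel_measurable borel" for n
    unfolding g_def by measurable
  have near_eq: "\<forall>\<^sub>F n in sequentially. (LINT t|lborel. g n t) = v n / T (y n) * (LINT s|lborel. indicator S s * f n s)"
    using pos
  proof eventually_elim
    case (elim n)
    have "(LINT s|lborel. indicator S s * f n s) = \<bar>1 / v n\<bar> *\<^sub>R (LINT t|lborel. indicator S (b + 1 / v n * t) * f n (b + 1 / v n * t))"
      by (rule lborel_integral_real_affine) (use elim in simp)
    also have "(LINT t|lborel. indicator S (b + 1 / v n * t) * f n (b + 1 / v n * t)) = T (y n) * (LINT t|lborel. g n t)"
      unfolding integral_mult_right_zero[symmetric]
      by (rule Bochner_Integration.integral_cong) (use tail_pos[of "y n"] in \<open>auto simp: g_def\<close>)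
    finally show ?case using elim tail_pos[of "y n"] by simp
  qed
  define G where "G t = h b * exp (- max (\<delta> - t / b) (\<eta> + t / b / (c * a)))" for t
  have G_meas [measurable]: "G \<in> borel_measurable borel" unfolding G_def by measurable
  have pw: "(\<lambda>n. g n t) \<longlonglongrightarrow> G t" for t
  proof -
    have tv: "(\<lambda>n. t / v n) \<longlonglongrightarrow> 0"
      by (rule tendsto_divide_0[OF tendsto_const filterlim_at_top_imp_at_infinity[OF v]])
    have s_lim: "(\<lambda>n. b + t / v n) \<longlonglongrightarrow> b" using tendsto_add[OF tendsto_const[of b] tv] by simp
    have "(\<lambda>n. h (b + t / v n) * (section_tail T z (x1 n) (y1 n) (b + t / v n) / T (y n))) \<longlonglongrightarrow> G t"
      unfolding G_def x1_def y1_def v_def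
      by (intro tendsto_mult isCont_tendsto_compose[OF h_cont s_lim[unfolded v_def]] section_tail_pointwise y p q)
    moreover have "\<forall>\<^sub>F n in sequentially. b + t / v n \<in> S"
      using topological_tendstoD[OF s_lim, of S] u0 by (simp add: S_def)
    then have "\<forall>\<^sub>F n in sequentially. h (b + t / v n) * (section_tail T z (x1 n) (y1 n) (b + t / v n) / T (y n)) = g n t"
      by eventually_elim (simp add: g_def f_def)
    ultimately show ?thesis by (rule tendsto_cong[THEN iffD1, rotated])
  qed
  obtain n0 where n0: "\<And>n t. n \<ge> n0 \<Longrightarrow> norm (g n t) \<le> C * inverse (1 + t\<^sup>2)"
  proof -
    have "\<forall>\<^sub>F n in sequentially. \<forall>t. norm (g n t) \<le> C * inverse (1 + t\<^sup>2)"
      using eventually_compose_filterlim[OF dom y] xy1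
    proof eventually_elim
      case (elim n)
      show ?case
      proof
        fix t
        show "norm (g n t) \<le> C * inverse (1 + t\<^sup>2)"
        proof (cases "b + t / v n \<in> S")
          case True
          then have "f n (b + t / v n) \<le> C * inverse (1 + t\<^sup>2) * T (y n)"
            using elim unfolding f_def v_def S_def by blast
          moreover have "0 \<le> f n (b + t / v n)"
            using h_nonneg section_tail_bounds by (simp add: f_def)
          ultimately show ?thesis using True tail_pos[of "y n"] by (simp add: g_def divide_le_eq)
        qed (use C in \<open>simp add: g_def\<close>)
      qed
    qed
    then show ?thesis using that unfolding eventually_sequentially by blast
  qed
  \<comment> \<open>The majorant is available only from \<open>n0\<close> on, while dominated
    convergence wants it at every index; hence the shift.\<close>
  have "(\<lambda>n. LINT t|lborel. g (n + n0) t) \<longlonglongrightarrow> (LINT t|lborel. G t)"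
  proof (rule integral_dominated_convergence[OF _ _ integrable_const_inverse_1_plus_square[of C]])
    show "AE t in lborel. (\<lambda>n. g (n + n0) t) \<longlonglongrightarrow> G t"
      using LIMSEQ_ignore_initial_segment[OF pw] by simp
    show "AE t in lborel. norm (g (n + n0) t) \<le> C * inverse (1 + t\<^sup>2)" for n
      using n0[of "n + n0"] by simp
  qed measurable
  then have "(\<lambda>n. LINT t|lborel. g n t) \<longlonglongrightarrow> (LINT t|lborel. G t)" by (rule LIMSEQ_offset)
  then have near: "(\<lambda>n. v n / T (y n) * (LINT s|lborel. indicator S s * f n s)) \<longlonglongrightarrow> (LINT t|lborel. G t)"
    by (rule tendsto_cong[THEN iffD1, OF near_eq])
  \<comment> \<open>Written with slope 1 / b so that \<open>integral_exp_neg_max_shift\<close> fits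
    with \<alpha> = 1 / b and k = c a.\<close>
  have "(LINT t|lborel. G t) = h b * (LINT t|lborel. exp (- max (\<delta> - 1 / b * t) (\<eta> + 1 / b * t / (c * a))))"
    unfolding G_def by simp
  also have "\<dots> = h b * (b * (c * a + 1) * exp (- ((c * a * \<eta> + \<delta>) / (c * a + 1))))"
    by (subst integral_exp_neg_max_shift) (use a b c in auto)
  finally have G_int: "(LINT t|lborel. G t) = h b * (b * (c * a + 1) * exp (- ((c * a * \<eta> + \<delta>) / (c * a + 1))))" .
  have "(\<lambda>n. v n / T (y n) * (LINT s|lborel. f n s)) \<longlonglongrightarrow> (LINT t|lborel. G t) + 0"
    unfolding split distrib_left by (rule tendsto_add[OF near far])
  then show ?thesis
    unfolding G_int add_0_right f_def x1_def y1_def .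
qed

end

section \<open>Independence and the joint tail\<close>

context prob_space
begin

lemma Int_stable_vimage: "Int_stable {X -` A \<inter> space M | A. A \<in> sets S}"
proof (safe intro!: Int_stableI)
  fix A B assume "A \<in> sets S" "B \<in> sets S"
  then show "\<exists>C. (X -` A \<inter> space M) \<inter> (X -` B \<inter> space M) = (X -` C \<inter> space M) \<and> C \<in> sets S"
    by (intro exI[of _ "A \<inter> B"]) auto
qed

lemma indep_varI:
  assumes rv: "random_variable S X" "random_variable T Y"
    and prod: "\<And>A B. A \<in> sets S \<Longrightarrow> B \<in> sets T \<Longrightarrow>
      prob ((X -` A \<inter> space M) \<inter> (Y -` B \<inter> space M)) = prob (X -` A \<inter> space M) * prob (Y -` B \<inter> space M)"
  shows "indep_var S X T Y"
  unfolding indep_var_eq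
  by (intro conjI indep_set_sigma_sets Int_stable_vimage rv indep_setI)
     (use rv prod in \<open>auto intro: measurable_sets\<close>)

context
  fixes A :: "'b measure" and B :: "'c measure" and C :: "'d measure"
    and f :: "'a \<Rightarrow> 'b" and g :: "'a \<Rightarrow> 'c" and h :: "'a \<Rightarrow> 'd"
  assumes indep: "indep_var3 A f B g C h"
begin

lemma indep_var3_rv: "random_variable A f" "random_variable B g" "random_variable C h"
  using indep by (simp_all add: indep_var3_def)

lemma indep_var3_prod:
  assumes "S \<in> sets A" "U \<in> sets B" "V \<in> sets C"
  shows "prob ((f -` S \<inter> space M) \<inter> ((g -` U \<inter> space M) \<inter> (h -` V \<inter> space M))) =
    prob (f -` S \<inter> space M) * (prob (g -` U \<inter> space M) * prob (h -` V \<inter> space M))" (is ?triple)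
    and "prob ((g -` U \<inter> space M) \<inter> (h -` V \<inter> space M)) = prob (g -` U \<inter> space M) * prob (h -` V \<inter> space M)" (is ?pair)
proof -
  define E where "E = (!) [f -` S \<inter> space M, g -` U \<inter> space M, h -` V \<inter> space M]"
  have E: "E j \<in> [{f -` S \<inter> space M | S. S \<in> sets A}, {g -` S \<inter> space M | S. S \<in> sets B},
      {h -` S \<inter> space M | S. S \<in> sets C}] ! j" if "j < 3" for j
    using that assms by (auto simp: E_def less_Suc_eq numeral_3_eq_3 intro: exI[of _ S] exI[of _ U] exI[of _ V])
  \<comment> \<open>Independence of a family covers its subfamilies, so the formula for a pair comes
    from the index set {1, 2}.\<close>
  have *: "prob (\<Inter>j\<in>J. E j) = (\<Prod>j\<in>J. prob (E j))" if "J \<subseteq> {..<3}" "J \<noteq> {}" for J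
    by (rule indep_setsD[OF conjunct2[OF conjunct2[OF conjunct2[OF indep[unfolded indep_var3_def]]]] that])
       (use that E finite_subset in auto)
  show ?triple using *[of "{0, 1, 2}"] by (simp add: E_def)
  show ?pair using *[of "{1, 2}"] by (simp add: E_def)
qed

text \<open>The first variable is independent of the pair of the other two. Preimages of rectangles
  form an intersection-stable generator on which the product formula is known, and independence
  passes to the generated sigma-algebras.\<close>

lemma indep_var3_pair_prob:
  assumes "S \<in> sets A" "D \<in> sets (B \<Otimes>\<^sub>M C)"
  shows "prob {\<omega> \<in> space M. f \<omega> \<in> S \<and> (g \<omega>, h \<omega>) \<in> D} =
    prob {\<omega> \<in> space M. f \<omega> \<in> S} * prob {\<omega> \<in> space M. (g \<omega>, h \<omega>) \<in> D}"
proof -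
  note [measurable] = indep_var3_rv
  let ?P = "\<lambda>\<omega>. (g \<omega>, h \<omega>)" and ?G = "{a \<times> b | a b. a \<in> sets B \<and> b \<in> sets C}"
  let ?F = "{f -` S \<inter> space M | S. S \<in> sets A}" and ?H = "{?P -` D \<inter> space M | D. D \<in> ?G}"
  have vim: "?P -` (a \<times> b) \<inter> space M = (g -` a \<inter> space M) \<inter> (h -` b \<inter> space M)" for a b by auto
  have ev: "f -` S \<inter> space M \<in> events" "g -` U \<inter> space M \<in> events" "h -` V \<inter> space M \<in> events"
    if "S \<in> sets A" "U \<in> sets B" "V \<in> sets C" for S U V
    using that indep_var3_rv by (auto intro: measurable_sets)
  have "indep_set ?F ?H"
  proof (rule indep_setI)
    show "?F \<subseteq> events" using ev by blast
    show "?H \<subseteq> events" using ev by (auto simp: vim)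
    fix a b assume "a \<in> ?F" "b \<in> ?H"
    then show "prob (a \<inter> b) = prob a * prob b"
      using indep_var3_prod by (auto simp: vim)
  qed
  moreover have "Int_stable ?H"
  proof (rule Int_stableI)
    fix a b assume "a \<in> ?H" "b \<in> ?H"
    then obtain a1 a2 b1 b2 where *: "a = ?P -` (a1 \<times> a2) \<inter> space M" "b = ?P -` (b1 \<times> b2) \<inter> space M"
      "a1 \<in> sets B" "a2 \<in> sets C" "b1 \<in> sets B" "b2 \<in> sets C" by blast
    then have "a \<inter> b = ?P -` ((a1 \<inter> b1) \<times> (a2 \<inter> b2)) \<inter> space M" by auto
    moreover have "(a1 \<inter> b1) \<times> (a2 \<inter> b2) \<in> ?G" using * by blast
    ultimately show "a \<inter> b \<in> ?H" by blast
  qed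
  ultimately have *: "indep_set (sigma_sets (space M) ?F) (sigma_sets (space M) ?H)"
    by (intro indep_set_sigma_sets Int_stable_vimage)
  have "?P \<in> space M \<rightarrow> space B \<times> space C"
    using indep_var3_rv(2,3)[THEN measurable_space] by auto
  from sigma_sets_vimage_commute[OF this, of ?G]
  have "?P -` D \<inter> space M \<in> sigma_sets (space M) ?H"
    using assms(2) unfolding sets_pair_measure by blast
  then have "prob ((f -` S \<inter> space M) \<inter> (?P -` D \<inter> space M)) = prob (f -` S \<inter> space M) * prob (?P -` D \<inter> space M)"
    by (rule indep_setD[OF *, rotated]) (use assms(1) in auto)
  moreover have "(f -` S \<inter> space M) \<inter> (?P -` D \<inter> space M) = {\<omega> \<in> space M. f \<omega> \<in> S \<and> (g \<omega>, h \<omega>) \<in> D}"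
    "f -` S \<inter> space M = {\<omega> \<in> space M. f \<omega> \<in> S}" "?P -` D \<inter> space M = {\<omega> \<in> space M. (g \<omega>, h \<omega>) \<in> D}" by auto
  ultimately show ?thesis by simp
qed

end

lemma indep_var3_imp_indep_var:
  assumes "indep_var3 A f B g B h"
  shows "indep_var B g B h"
  by (intro indep_varI indep_var3_rv[OF assms] indep_var3_prod(2)[OF assms]) auto

text \<open>The joint law is a product measure. Tonelli integrates the sections at fixed W = s, and
  the law of W is replaced by its density.\<close>

lemma indep_var_density_prob:
  fixes R W :: "'a \<Rightarrow> real"
  assumes indep: "indep_var borel R borel W" and dens: "distributed M lborel W (\<lambda>x. ennreal (h x))"
    and h: "\<And>x. 0 \<le> h x" and B [measurable]: "B \<in> sets (borel \<Otimes>\<^sub>M borel)"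
  shows "prob {\<omega> \<in> space M. (R \<omega>, W \<omega>) \<in> B} =
      (LINT s|lborel. h s * measure (distr M borel R) {r. (r, s) \<in> B})"
proof -
  have [measurable]: "R \<in> borel_measurable M" "W \<in> borel_measurable M"
    using indep by (auto simp: indep_var_distribution_eq)
  have h_meas [measurable]: "h \<in> borel_measurable borel"
  proof -
    \<comment> \<open>Only \<open>ennreal (h x)\<close> is known to be measurable; for nonnegative
      \<open>h\<close> this can be undone.\<close>
    have "(\<lambda>x. enn2real (ennreal (h x))) \<in> borel_measurable lborel"
      using distributed_borel_measurable[OF dens] by measurable
    then show ?thesis using h by simp
  qed
  interpret R: prob_space "distr M borel R" by (rule prob_space_distr) measurable
  interpret W: prob_space "distr M borel W" by (rule prob_space_distr) measurable
  interpret pair_sigma_finite "distr M borel R" "distr M borel W" ..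
  have B': "B \<in> sets (distr M borel R \<Otimes>\<^sub>M distr M borel W)"
    using B by (simp cong: sets_pair_measure_cong)
  have sect: "(\<lambda>r. (r, s)) -` B = {r. (r, s) \<in> B}" for s by auto
  have meas: "(\<lambda>s. emeasure (distr M borel R) {r. (r, s) \<in> B}) \<in> borel_measurable borel"
    using measurable_emeasure_Pair2[OF B'] by (simp add: sect)
  then have [measurable]: "(\<lambda>s. measure (distr M borel R) {r. (r, s) \<in> B}) \<in> borel_measurable borel"
    unfolding measure_def by measurable
  have "emeasure M {\<omega> \<in> space M. (R \<omega>, W \<omega>) \<in> B} = emeasure (distr M (borel \<Otimes>\<^sub>M borel) (\<lambda>\<omega>. (R \<omega>, W \<omega>))) B"
    by (subst emeasure_distr) (auto intro!: arg_cong[where f = "emeasure M"])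
  also have "\<dots> = emeasure (distr M borel R \<Otimes>\<^sub>M distr M borel W) B"
    using indep by (simp add: indep_var_distribution_eq)
  also have "\<dots> = (\<integral>\<^sup>+ s. emeasure (distr M borel R) {r. (r, s) \<in> B} \<partial>distr M borel W)"
    unfolding emeasure_pair_measure_alt2[OF B'] sect ..
  also have "distr M borel W = density lborel (\<lambda>x. ennreal (h x))"
    using distributed_distr_eq_density[OF dens] by (simp cong: distr_cong)
  also have "(\<integral>\<^sup>+ s. emeasure (distr M borel R) {r. (r, s) \<in> B} \<partial>density lborel (\<lambda>x. ennreal (h x))) =
      (\<integral>\<^sup>+ s. ennreal (h s) * emeasure (distr M borel R) {r. (r, s) \<in> B} \<partial>lborel)"
    using meas by (subst nn_integral_density) auto
  also have "\<dots> = (\<integral>\<^sup>+ s. ennreal (h s * measure (distr M borel R) {r. (r, s) \<in> B}) \<partial>lborel)"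
    using h by (simp add: R.emeasure_eq_measure ennreal_mult)
  finally show ?thesis
    unfolding measure_def[of M] using h
    by (subst integral_eq_nn_integral) (auto intro!: AE_I2)
qed

end

section \<open>The polar representation and its joint tail\<close>

locale polar_model = prob_space N for N :: "'b measure" +
  fixes I1 I2 R W :: "'b \<Rightarrow> real" and \<rho> :: real and z_star h :: "real \<Rightarrow> real"
  assumes indep: "indep_var3 borel (\<lambda>\<omega>. (I1 \<omega>, I2 \<omega>)) borel R borel W"
    and range: "\<forall>\<omega>\<in>space N. I1 \<omega> \<in> {-1, 1} \<and> I2 \<omega> \<in> {-1, 1} \<and> 0 < R \<omega> \<and> W \<omega> \<in> {0<..<1}"
    and zs_meas: "z_star \<in> borel_measurable (restrict_space borel {0..1})"
    and zs_pos: "\<forall>x\<in>{0..1}. 0 < z_star x"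
    and dens: "distributed N lborel W (\<lambda>x. ennreal (h x))"
begin

text \<open>The function z, extended by 0 beyond [0,1] so as to be Borel measurable on the whole
  line.\<close>

definition ray :: "real \<Rightarrow> real" where
  "ray s = (if s \<in> {0..1} then \<rho> * s + z_star s else 0)"

text \<open>A version of the density of W with good values everywhere. Truncation at 0 does not
  alter \<open>ennreal (h x)\<close>, and W takes its values in (0,1).\<close>

definition dens01 :: "real \<Rightarrow> real" where
  "dens01 s = max 0 (h s) * indicator {0<..<1} s"

definition tail :: "real \<Rightarrow> real" where
  "tail x = measure (distr N borel R) {x<..}"

lemma rv [measurable]:
  "I1 \<in> borel_measurable N" "I2 \<in> borel_measurable N" "R \<in> borel_measurable N" "W \<in> borel_measurable N"
proof -
  note * = indep_var3_rv[OF indep]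
  show "R \<in> borel_measurable N" "W \<in> borel_measurable N" by (rule *)+
  have I: "(\<lambda>\<omega>. (I1 \<omega>, I2 \<omega>)) \<in> N \<rightarrow>\<^sub>M borel \<Otimes>\<^sub>M borel" using *(1) by (simp add: borel_prod)
  show "I1 \<in> borel_measurable N" using measurable_compose[OF I measurable_fst] by simp
  show "I2 \<in> borel_measurable N" using measurable_compose[OF I measurable_snd] by simp
qed

lemma ray_meas [measurable]: "ray \<in> borel_measurable borel"
proof -
  have [measurable]: "(\<lambda>s. indicator {0..1} s *\<^sub>R z_star s) \<in> borel_measurable borel"
    using zs_meas by (simp add: borel_measurable_restrict_space_iff)
  have "ray = (\<lambda>s. indicator {0..1} s * (\<rho> * s) + indicator {0..1} s *\<^sub>R z_star s)"
    by (auto simp: ray_def fun_eq_iff)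
  also have "\<dots> \<in> borel_measurable borel" by measurable
  finally show ?thesis .
qed

sublocale R: prob_space "distr N borel R"
  by (rule prob_space_distr) measurable

lemma dens_pos: "distributed N lborel W (\<lambda>x. ennreal (max 0 (h x)))"
proof -
  have "(\<lambda>x. ennreal (max 0 (h x))) = (\<lambda>x. ennreal (h x))"
    by (auto simp: fun_eq_iff max_def ennreal_neg)
  with dens show ?thesis by simp
qed

lemma density_prob:
  assumes B: "B \<in> sets (borel \<Otimes>\<^sub>M borel)" and B01: "B \<subseteq> UNIV \<times> {0<..<1}"
  shows "prob {\<omega> \<in> space N. (R \<omega>, W \<omega>) \<in> B} = (LINT s|lborel. dens01 s * measure (distr N borel R) {r. (r, s) \<in> B})"
proof -
  have "prob {\<omega> \<in> space N. (R \<omega>, W \<omega>) \<in> B} =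
      (LINT s|lborel. max 0 (h s) * measure (distr N borel R) {r. (r, s) \<in> B})"
    by (rule indep_var_density_prob[OF indep_var3_imp_indep_var[OF indep] dens_pos _ B]) simp
  also have "\<dots> = (LINT s|lborel. dens01 s * measure (distr N borel R) {r. (r, s) \<in> B})"
  proof (rule Bochner_Integration.integral_cong[OF refl])
    fix s
    have "{r. (r, s) \<in> B} = {}" if "s \<notin> {0<..<1}" using B01 that by auto
    then show "max 0 (h s) * measure (distr N borel R) {r. (r, s) \<in> B} = dens01 s * measure (distr N borel R) {r. (r, s) \<in> B}"
      by (cases "s \<in> {0<..<1}") (auto simp: dens01_def)
  qed
  finally show ?thesis .
qed

lemma dens01_mass: "(LINT s|lborel. dens01 s) = 1"
proof -
  have B: "(UNIV :: real set) \<times> {0<..<1::real} \<in> sets (borel \<Otimes>\<^sub>M borel)" by measurable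
  have "prob {\<omega> \<in> space N. (R \<omega>, W \<omega>) \<in> UNIV \<times> {0<..<1}} = prob (space N)"
    using range by (intro arg_cong[where f = prob]) auto
  then have "1 = (LINT s|lborel. dens01 s * measure (distr N borel R) {r. (r, s) \<in> UNIV \<times> {0<..<1}})"
    unfolding density_prob[OF B order_refl] by (simp add: prob_space)
  also have "\<dots> = (LINT s|lborel. dens01 s)"
  proof (rule Bochner_Integration.integral_cong[OF refl])
    fix s
    show "dens01 s * measure (distr N borel R) {r. (r, s) \<in> UNIV \<times> {0<..<1}} = dens01 s"
      using R.prob_space by (cases "s \<in> {0<..<1}") (auto simp: dens01_def)
  qed
  finally show ?thesis by simp
qed

text \<open>The Bochner integral of a non-integrable function is 0 by convention, whereas here it is
  1.\<close>

lemma dens01_integrable: "integrable lborel dens01"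
  using dens01_mass not_integrable_integral_eq by fastforce

text \<open>Up to the event \<open>I1 = 1, I2 = -1\<close>, on which \<open>W < 1\<close> and \<open>z_star > 0\<close> force \<open>\<rho> R > y\<close>,
  the joint tail is that of \<open>(R W, R (ray W))\<close> on \<open>I1 = I2 = 1\<close>.\<close>

lemma joint_tail_bounds:
  fixes x y :: real
  assumes "0 < x" "0 < y"
  defines "E \<equiv> {\<omega> \<in> space N. x < R \<omega> * I1 \<omega> * W \<omega> \<and> y < \<rho> * R \<omega> * I1 \<omega> * W \<omega> + R \<omega> * I2 \<omega> * z_star (W \<omega>)}"
    and "J \<equiv> prob {\<omega> \<in> space N. I1 \<omega> = 1 \<and> I2 \<omega> = 1} * (LINT s|lborel. dens01 s * section_tail tail ray x y s)"
  shows "J \<le> prob E" and "prob E \<le> J + (if 0 < \<rho> then tail (y / \<rho>) else 0)"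
proof -
  \<comment> \<open>The region for (R, W) when I1 = I2 = 1. Its section at each s in (0,1) is a
    half-line or empty, and restricting s to (0,1) permits \<open>density_prob\<close>.\<close>
  define B where "B = {q \<in> space (borel \<Otimes>\<^sub>M borel :: (real \<times> real) measure).
    0 < fst q \<and> 0 < snd q \<and> snd q < 1 \<and> x < fst q * snd q \<and> y < fst q * ray (snd q)}"
  have B_iff: "(r, s) \<in> B \<longleftrightarrow> 0 < r \<and> 0 < s \<and> s < 1 \<and> x < r * s \<and> y < r * ray s" for r s
    by (simp add: B_def space_pair_measure)
  have B_meas: "B \<in> sets (borel \<Otimes>\<^sub>M borel)" unfolding B_def by measurable
  have sect: "measure (distr N borel R) {r. (r, s) \<in> B} = section_tail tail ray x y s" if s: "s \<in> {0<..<1}" for s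
  proof (cases "0 < ray s")
    case True
    have *: "(0 < r \<and> x < r * s \<and> y < r * ray s) \<longleftrightarrow> max (x / s) (y / ray s) < r" for r
    proof -
      have "0 < r" if "x < r * s"
      proof -
        have "0 < r * s" using that assms(1) by linarith
        then show ?thesis using s by (simp add: zero_less_mult_iff)
      qed
      moreover have "x / s < r \<longleftrightarrow> x < r * s" "y / ray s < r \<longleftrightarrow> y < r * ray s"
        using s True by (simp_all add: pos_divide_less_eq)
      ultimately show ?thesis unfolding max_less_iff_conj by blast
    qed
    have "{r. (r, s) \<in> B} = {max (x / s) (y / ray s)<..}"
    proof (rule set_eqI)
      fix r
      have "r \<in> {r. (r, s) \<in> B} \<longleftrightarrow> 0 < r \<and> x < r * s \<and> y < r * ray s"
        using s by (simp add: B_iff)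
      also note *
      finally show "r \<in> {r. (r, s) \<in> B} \<longleftrightarrow> r \<in> {max (x / s) (y / ray s)<..}" by simp
    qed
    then show ?thesis using True s by (simp add: section_tail_def tail_def)
  next
    case False
    have "\<not> (0 < r \<and> y < r * ray s)" for r
      using False assms mult_nonneg_nonpos[of r "ray s"] by force
    then have "{r. (r, s) \<in> B} = {}" by (auto simp: B_iff)
    then show ?thesis using False by (simp add: section_tail_def)
  qed
  have "prob {\<omega> \<in> space N. (R \<omega>, W \<omega>) \<in> B} = (LINT s|lborel. dens01 s * measure (distr N borel R) {r. (r, s) \<in> B})"
    by (rule density_prob[OF B_meas]) (auto simp: B_iff)
  also have "\<dots> = (LINT s|lborel. dens01 s * section_tail tail ray x y s)"
  proof (rule Bochner_Integration.integral_cong[OF refl])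
    fix s show "dens01 s * measure (distr N borel R) {r. (r, s) \<in> B} = dens01 s * section_tail tail ray x y s"
      using sect[of s] by (cases "s \<in> {0<..<1}") (auto simp: dens01_def)
  qed
  finally have int: "prob {\<omega> \<in> space N. (R \<omega>, W \<omega>) \<in> B} = (LINT s|lborel. dens01 s * section_tail tail ray x y s)" .
  define E1 where "E1 = {\<omega> \<in> space N. (I1 \<omega>, I2 \<omega>) \<in> {(1, 1)} \<and> (R \<omega>, W \<omega>) \<in> B}"
  have "prob E1 = prob {\<omega> \<in> space N. (I1 \<omega>, I2 \<omega>) \<in> {(1, 1)}} * prob {\<omega> \<in> space N. (R \<omega>, W \<omega>) \<in> B}"
    unfolding E1_def by (rule indep_var3_pair_prob[OF indep _ B_meas]) simp
  then have J: "J = prob E1" by (simp add: J_def int)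
  have ray_W: "ray (W \<omega>) = \<rho> * W \<omega> + z_star (W \<omega>)" if "\<omega> \<in> space N" for \<omega>
    using range that by (auto simp: ray_def)
  \<comment> \<open>\<open>z_star\<close> is measurable only relative to [0,1]; writing it through
    \<open>ray\<close> makes the event visibly measurable.\<close>
  have E_eq: "E = {\<omega> \<in> space N. x < R \<omega> * I1 \<omega> * W \<omega> \<and>
      y < \<rho> * R \<omega> * I1 \<omega> * W \<omega> + R \<omega> * I2 \<omega> * (ray (W \<omega>) - \<rho> * W \<omega>)}"
    using ray_W by (auto simp: E_def)
  have E_meas: "E \<in> events" unfolding E_eq by measurable
  have E1_meas: "E1 \<in> events"
  proof -
    have "E1 = {\<omega> \<in> space N. I1 \<omega> = 1 \<and> I2 \<omega> = 1 \<and> (R \<omega>, W \<omega>) \<in> B}" by (auto simp: E1_def)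
    also have "\<dots> \<in> events" using B_meas by measurable
    finally show ?thesis .
  qed
  have "E1 \<subseteq> E"
    using ray_W by (auto simp: E1_def E_def B_iff algebra_simps)
  then show "J \<le> prob E" unfolding J by (intro finite_measure_mono E_meas)
  define E2 where "E2 = {\<omega> \<in> space N. 0 < \<rho> \<and> y / \<rho> < R \<omega>}"
  have E2_meas: "E2 \<in> events" unfolding E2_def by measurable
  have "E \<subseteq> E1 \<union> E2"
  proof
    fix \<omega> assume \<omega>: "\<omega> \<in> E"
    then have sp: "\<omega> \<in> space N" by (simp add: E_def)
    with range have rg: "I1 \<omega> = -1 \<or> I1 \<omega> = 1" "I2 \<omega> = -1 \<or> I2 \<omega> = 1" "0 < R \<omega>" "0 < W \<omega>" "W \<omega> < 1" by auto
    have xE: "x < R \<omega> * I1 \<omega> * W \<omega>" and yE: "y < \<rho> * R \<omega> * I1 \<omega> * W \<omega> + R \<omega> * I2 \<omega> * z_star (W \<omega>)"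
      using \<omega> by (auto simp: E_def)
    have I1: "I1 \<omega> = 1"
    proof (rule ccontr)
      assume "I1 \<omega> \<noteq> 1"
      then have "x < - (R \<omega> * W \<omega>)" using rg xE by auto
      moreover have "0 < R \<omega> * W \<omega>" using rg by simp
      ultimately show False using assms by linarith
    qed
    show "\<omega> \<in> E1 \<union> E2"
    proof (cases "I2 \<omega> = 1")
      case True
      then have "\<omega> \<in> E1" using I1 xE yE rg sp by (auto simp: E1_def B_iff ray_W algebra_simps)
      then show ?thesis ..
    next
      case False
      then have "I2 \<omega> = -1" using rg by simp
      then have "y < \<rho> * R \<omega> * W \<omega> - R \<omega> * z_star (W \<omega>)" using yE I1 by simp
      moreover have "0 < R \<omega> * z_star (W \<omega>)" using rg zs_pos by simp
      ultimately have y: "y < \<rho> * (R \<omega> * W \<omega>)" by (simp add: algebra_simps)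
      have RW: "0 < R \<omega> * W \<omega>" "R \<omega> * W \<omega> < R \<omega>" using rg by simp_all
      have "0 < \<rho>" using y RW assms by (meson order.strict_trans zero_less_mult_pos2)
      with RW have "\<rho> * (R \<omega> * W \<omega>) < \<rho> * R \<omega>" by (intro mult_strict_left_mono)
      with y have "y < \<rho> * R \<omega>" by linarith
      with \<open>0 < \<rho>\<close> have "\<omega> \<in> E2" using sp by (simp add: E2_def pos_divide_less_eq mult.commute)
      then show ?thesis ..
    qed
  qed
  then have "prob E \<le> prob (E1 \<union> E2)" by (rule finite_measure_mono) (intro sets.Un E1_meas E2_meas)
  also have "\<dots> \<le> prob E1 + prob E2" by (rule measure_Un_le[OF E1_meas E2_meas])
  also have "prob E2 = (if 0 < \<rho> then tail (y / \<rho>) else 0)"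
  proof (cases "0 < \<rho>")
    case True
    have "tail (y / \<rho>) = prob (R -` {y / \<rho><..} \<inter> space N)"
      unfolding tail_def by (rule measure_distr) measurable
    also have "R -` {y / \<rho><..} \<inter> space N = E2" using True by (auto simp: E2_def)
    finally show ?thesis using True by simp
  qed (simp add: E2_def)
  finally show "prob E \<le> J + (if 0 < \<rho> then tail (y / \<rho>) else 0)" unfolding J .
qed

end

section \<open>The asymptotic equivalence\<close>

text \<open>If uniformity failed, some points x_n tending to infinity and p_n in \<open>K\<close>
  would keep the values away from \<open>l\<close>. By compactness p_n converges along a
  subsequence, contradicting \<open>seq\<close>. Local uniformity thus becomes a statement about
  convergent parameter sequences.\<close>

lemma uniform_limit_at_top_sequentialI:
  fixes f :: "real \<Rightarrow> 'a::metric_space \<Rightarrow> 'b::metric_space"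
  assumes "compact K"
    and seq: "\<And>X P p. filterlim X at_top sequentially \<Longrightarrow> (\<And>n. P n \<in> K) \<Longrightarrow> P \<longlonglongrightarrow> p \<Longrightarrow> p \<in> K \<Longrightarrow>
      (\<lambda>n. f (X n) (P n)) \<longlonglongrightarrow> l"
  shows "uniform_limit K f (\<lambda>_. l) at_top"
proof (rule ccontr)
  assume "\<not> ?thesis"
  then obtain e where e: "0 < e" "\<And>N. \<exists>x\<ge>N. \<exists>p\<in>K. e \<le> dist (f x p) l"
    unfolding uniform_limit_iff eventually_at_top_linorder by (auto simp: not_less)
  have "\<forall>n. \<exists>x p. real n \<le> x \<and> p \<in> K \<and> e \<le> dist (f x p) l" using e(2) by meson
  then obtain X P where XP: "\<And>n. real n \<le> X n" "\<And>n. P n \<in> K" "\<And>n. e \<le> dist (f (X n) (P n)) l"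
    by metis
  obtain p s where p: "p \<in> K" "strict_mono s" "(P \<circ> s) \<longlonglongrightarrow> p"
    using \<open>compact K\<close> XP(2) unfolding compact_def by meson
  have "filterlim X at_top sequentially"
    by (rule filterlim_at_top_mono[OF filterlim_real_sequentially]) (use XP(1) in simp)
  then have "filterlim (\<lambda>n. X (s n)) at_top sequentially"
    by (rule filterlim_compose) (rule filterlim_subseq[OF p(2)])
  from seq[OF this _ _ p(1), of "P \<circ> s"] p(3) XP(2)
  have "(\<lambda>n. f (X (s n)) (P (s n))) \<longlonglongrightarrow> l" by (simp add: o_def)
  from tendstoD[OF this e(1)] have "\<exists>n. dist (f (X (s n)) (P (s n))) l < e"
    unfolding eventually_sequentially by blast
  with XP(3) show False by (meson not_less)
qed

theorem proposition3:
  fixes M :: "'a measure" and N :: "'b measure"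
    and X Y :: "'a \<Rightarrow> real" and I\<^sub>1 I\<^sub>2 R W :: "'b \<Rightarrow> real"
    and \<rho> a a\<^sub>\<rho> \<epsilon> c \<gamma> K\<^sub>1 K\<^sub>2 :: real
    and z_star z F w v h L :: "real \<Rightarrow> real"
  assumes "prob_space M" and "prob_space N"
    and "\<rho> \<in> {-1<..<1}" and "a \<in> {0<..1}"
    and "X \<in> borel_measurable M" and "Y \<in> borel_measurable M"
    and XY_distr: "distr M borel (\<lambda>\<omega>. (X \<omega>, Y \<omega>)) =
      distr N borel (\<lambda>\<omega>. (R \<omega> * I\<^sub>1 \<omega> * W \<omega>,
                          \<rho> * R \<omega> * I\<^sub>1 \<omega> * W \<omega> + R \<omega> * I\<^sub>2 \<omega> * z_star (W \<omega>)))"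
    and indep: "prob_space.indep_var3 N borel (\<lambda>\<omega>. (I\<^sub>1 \<omega>, I\<^sub>2 \<omega>)) borel R borel W"
    and "\<forall>\<omega>\<in>space N. I\<^sub>1 \<omega> \<in> {-1, 1} \<and> I\<^sub>2 \<omega> \<in> {-1, 1} \<and> 0 < R \<omega> \<and> W \<omega> \<in> {0<..<1}"
    and "measure N {\<omega>\<in>space N. I\<^sub>1 \<omega> = 1 \<and> I\<^sub>2 \<omega> = 1} \<in> {0<..1}"
    and "z_star \<in> borel_measurable (restrict_space borel {0..1})"
    and "\<forall>x\<in>{0..1}. 0 < z_star x \<and> z_star x \<le> 1"
    and F: "F = cdf (distr N borel R)" and "upper_endpoint F = \<infinity>"
    and "upper_endpoint (cdf (distr N borel W)) = 1"
    and z: "\<forall>x\<in>{0..1}. z x = \<rho> * x + z_star x"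
    and adm: "admissible \<rho> a z a\<^sub>\<rho> \<epsilon> c"
    and z_away: "\<exists>\<kappa><a / a\<^sub>\<rho>. \<forall>x\<in>{1 / a\<^sub>\<rho> + \<epsilon>..1}. z x \<le> \<kappa>"
    and "\<forall>x>0. 0 < w x" and "F \<in> GMDA w"
    and "K\<^sub>1 = - (1 / a\<^sub>\<rho>)" and "K\<^sub>2 = c * a / a\<^sub>\<rho>"
    and W_asymp: "(\<lambda>u. measure N {\<omega>\<in>space N. W \<omega> - 1 / a\<^sub>\<rho> \<in> {K\<^sub>1 * u<..<K\<^sub>2 * u}})
          \<sim>[at_right 0] (\<lambda>u. L u * u powr \<gamma>)"
    and "0 \<le> \<gamma>" and "locally_bounded_on {0<..} L" and "slowly_varying_at_0 L"
    and "distributed N lborel W (\<lambda>x. ennreal (h x))"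
    and "\<forall>x\<in>{0<..<1}. 0 < h x" and "isCont h (1 / a\<^sub>\<rho>)"
    and v: "\<forall>x>0. v x = x * w x"
  shows "(\<forall>r \<epsilon>' c'. admissible \<rho> a z r \<epsilon>' c' \<longrightarrow> r = a\<^sub>\<rho>) \<and>
    asymp_equiv_loc_unif at_top ({0..} \<times> {0..})
      (\<lambda>x (\<delta>, \<eta>). measure M {\<omega>\<in>space M. X \<omega> > x * (1 + \<delta> / v (a\<^sub>\<rho> * x)) \<and>
                                          Y \<omega> > a * x * (1 + \<eta> / v (a\<^sub>\<rho> * x))})
      (\<lambda>x (\<delta>, \<eta>). measure N {\<omega>\<in>space N. I\<^sub>1 \<omega> = 1 \<and> I\<^sub>2 \<omega> = 1} *
         (h (1 / a\<^sub>\<rho>) / a\<^sub>\<rho>) * (c * a + 1) *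
         exp (- ((c * a * \<eta> + \<delta>) / (c * a + 1))) *
         ((1 - F (a\<^sub>\<rho> * x)) / v (a\<^sub>\<rho> * x)))"
proof (intro conjI allI impI)
  have a: "0 < a" using \<open>a \<in> {0<..1}\<close> by simp
  show "r = a\<^sub>\<rho>" if "admissible \<rho> a z r \<epsilon>' c'" for r \<epsilon>' c'
    using admissible_unique[OF that adm a] .

  \<comment> \<open>Verification of the hypotheses of the analytic limit\<close>
  define b where "b = 1 / a\<^sub>\<rho>"
  define T where "T = (\<lambda>x. 1 - F x)"
  define p11 where "p11 = measure N {\<omega> \<in> space N. I\<^sub>1 \<omega> = 1 \<and> I\<^sub>2 \<omega> = 1}"
  have p11: "0 < p11" using \<open>measure N {\<omega>\<in>space N. I\<^sub>1 \<omega> = 1 \<and> I\<^sub>2 \<omega> = 1} \<in> {0<..1}\<close> by (simp add: p11_def)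
  have b: "0 < b" "b < 1" using admissible_pos[OF adm] by (auto simp: b_def)
  have c: "0 < c" and \<epsilon>: "0 < \<epsilon>" using admissible_pos[OF adm] by auto
  have ab: "0 < a * b" using a b by simp
  have a_div: "a / a\<^sub>\<rho> = a * b" by (simp add: b_def)
  interpret polar_model N I\<^sub>1 I\<^sub>2 R W \<rho> z_star h
  proof (intro polar_model.intro polar_model_axioms.intro)
    show "\<forall>x\<in>{0..1}. 0 < z_star x" using \<open>\<forall>x\<in>{0..1}. 0 < z_star x \<and> z_star x \<le> 1\<close> by blast
  qed fact+
  interpret PR: real_distribution "distr N borel R"
    by (rule real_distribution_distr) measurable
  have T_tail: "T = tail"
  proof
    fix x
    have "measure (distr N borel R) (UNIV - {..x}) = 1 - measure (distr N borel R) {..x}"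
      using R.prob_compl[of "{..x}"] by simp
    moreover have "UNIV - {..x} = {x<..}" by auto
    ultimately show "T x = tail x" by (simp add: T_def F tail_def cdf_def)
  qed
  have T_anti: "antimono T"
    unfolding T_def F by (intro antimonoI) (simp add: PR.cdf_nondecreasing)
  have T_pos: "0 < T x" for x
  proof -
    have "ereal x < (SUP x\<in>{x. F x < 1}. ereal x)"
      using \<open>upper_endpoint F = \<infinity>\<close> unfolding upper_endpoint_def by simp
    then obtain x' where "F x' < 1" "x < x'" by (auto simp: less_SUP_iff)
    moreover have "F x \<le> F x'" unfolding F using \<open>x < x'\<close> by (intro PR.cdf_nondecreasing) simp
    ultimately show ?thesis by (simp add: T_def)
  qed
  have T_lim: "(T \<longlongrightarrow> 0) at_top"
    using tendsto_diff[OF tendsto_const[of 1] PR.cdf_lim_at_top_prob] unfolding T_def F by simp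
  interpret G: gumbel_tail T w
    using T_anti T_pos T_lim \<open>\<forall>x>0. 0 < w x\<close> \<open>F \<in> GMDA w\<close>
    by unfold_locales (auto simp: GMDA_def T_def)
  have ray_eq: "ray s = z s" if "s \<in> {0..1}" for s using z that by (auto simp: ray_def)
  have ray_b: "ray b = a * b"
    using ray_eq[of b] b admissible_value[OF adm] by (simp add: b_def)
  have ray_deriv: "(ray has_real_derivative - (1 / c)) (at b)"
    by (rule has_field_derivative_transform_within_open[OF admissible_DERIV[OF adm, folded b_def], of "{0<..<1}"])
       (use b ray_eq in auto)
  \<comment> \<open>Beyond b + \<epsilon> the bound is \<open>z_away\<close>; between b + u and b +
    \<epsilon> it comes from strict monotonicity, through the value of z at an intermediate
    point.\<close>
  have ray_away: "\<exists>\<kappa><a * b. \<forall>s\<in>{b + u..1}. ray s \<le> \<kappa>" if u: "0 < u" for u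
  proof -
    obtain \<kappa> where \<kappa>: "\<kappa> < a * b" "\<And>s. s \<in> {b + \<epsilon>..1} \<Longrightarrow> z s \<le> \<kappa>"
      using z_away unfolding a_div b_def[symmetric] by blast
    \<comment> \<open>b + u' must lie in the monotonicity interval and in [0,1] and must not exceed
      b + u, even when u is large.\<close>
    define u' where "u' = min u (min \<epsilon> (1 - b))"
    have u': "0 < u'" "u' \<le> u" "u' \<le> \<epsilon>" "b + u' \<le> 1" using u \<epsilon> b by (auto simp: u'_def)
    have V: "V_nbhd a\<^sub>\<rho> \<epsilon> = {b - \<epsilon>..b + \<epsilon>} \<inter> {0..1}" by (simp add: V_nbhd_def b_def)
    note anti = admissible_antimono[OF adm, unfolded V]
    have "z (b + u') < z b" using u' b \<epsilon> by (intro anti) auto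
    then have "max \<kappa> (z (b + u')) < a * b"
      using \<kappa>(1) ray_b ray_eq[of b] b by simp
    moreover have "ray s \<le> max \<kappa> (z (b + u'))" if s: "s \<in> {b + u..1}" for s
    proof (cases "s \<le> b + \<epsilon>")
      case True
      have "z s \<le> z (b + u')"
      proof (cases "s = b + u'")
        case False
        with s u' have "b + u' < s" by auto
        then have "z s < z (b + u')" using u' b \<epsilon> s True by (intro anti) auto
        then show ?thesis by simp
      qed simp
      then show ?thesis using ray_eq[of s] s u b by (simp add: le_max_iff_disj)
    next
      case False
      then have "z s \<le> \<kappa>" using s by (intro \<kappa>(2)) auto
      then show ?thesis using ray_eq[of s] s u b by (simp add: le_max_iff_disj)
    qed
    ultimately show ?thesis by blast
  qed
  have dens01_eq: "dens01 s = h s" if "s \<in> {0<..<1}" for s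
  proof -
    have "0 < h s" using that \<open>\<forall>x\<in>{0<..<1}. 0 < h x\<close> by blast
    then show ?thesis using that by (simp add: dens01_def)
  qed
  have dens01_cont: "isCont dens01 b"
  proof -
    have "\<forall>\<^sub>F s in nhds b. s \<in> {0<..<1}"
      using b by (intro eventually_nhds_in_open) auto
    then have "\<forall>\<^sub>F s in nhds b. dens01 s = h s" by eventually_elim (rule dens01_eq)
    then show ?thesis using isCont_cong \<open>isCont h (1 / a\<^sub>\<rho>)\<close> unfolding b_def by blast
  qed
  interpret C: ray_crossing T w dens01 ray a b c
  proof
    show "T x \<le> 1" for x unfolding T_tail tail_def by simp
    show "0 \<le> dens01 s" for s by (simp add: dens01_def)
    show "dens01 s = 0" if "s \<notin> {0<..<1}" for s using that by (simp add: dens01_def)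
  qed (use a b c ray_meas dens01_integrable dens01_mass dens01_cont ray_b ray_deriv ray_away in auto)
  \<comment> \<open>For I2 = -1 and \<rho> > 0 the event forces R > y1 / \<rho> \<ge> (a b / \<rho>)
    y, and a_rho < a / |\<rho>| says exactly that this factor exceeds 1. Otherwise any number above
    1 will do.\<close>
  define k where "k = (if 0 < \<rho> then a * b / \<rho> else 2)"
  have k: "1 < k"
  proof (cases "0 < \<rho>")
    case True
    then have "a\<^sub>\<rho> < a / \<rho>" using adm by (auto simp: admissible_def)
    then show ?thesis using True admissible_pos(1)[OF adm] by (simp add: k_def b_def field_simps)
  qed (simp add: k_def)

  \<comment> \<open>Transfer of the event from (X, Y) to the polar variables\<close>
  define E where "E x y = {\<omega> \<in> space M. X \<omega> > x \<and> Y \<omega> > y}" for x y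
  define E' where "E' x y = {\<omega> \<in> space N. x < R \<omega> * I\<^sub>1 \<omega> * W \<omega> \<and> y < \<rho> * R \<omega> * I\<^sub>1 \<omega> * W \<omega> + R \<omega> * I\<^sub>2 \<omega> * z_star (W \<omega>)}" for x y
  have E_prob: "measure M (E x y) = prob (E' x y)" for x y
  proof -
    have [measurable]: "X \<in> borel_measurable M" "Y \<in> borel_measurable M" by fact+
    have meas: "(\<lambda>\<omega>. (R \<omega> * I\<^sub>1 \<omega> * W \<omega>, \<rho> * R \<omega> * I\<^sub>1 \<omega> * W \<omega> + R \<omega> * I\<^sub>2 \<omega> * z_star (W \<omega>))) \<in> borel_measurable N"
    proof (rule measurable_cong[THEN iffD1])
      show "(\<lambda>\<omega>. (R \<omega> * I\<^sub>1 \<omega> * W \<omega>, \<rho> * R \<omega> * I\<^sub>1 \<omega> * W \<omega> + R \<omega> * I\<^sub>2 \<omega> * (ray (W \<omega>) - \<rho> * W \<omega>))) \<in> borel_measurable N"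
        by measurable
      fix \<omega> assume "\<omega> \<in> space N"
      then show "(R \<omega> * I\<^sub>1 \<omega> * W \<omega>, \<rho> * R \<omega> * I\<^sub>1 \<omega> * W \<omega> + R \<omega> * I\<^sub>2 \<omega> * (ray (W \<omega>) - \<rho> * W \<omega>)) =
        (R \<omega> * I\<^sub>1 \<omega> * W \<omega>, \<rho> * R \<omega> * I\<^sub>1 \<omega> * W \<omega> + R \<omega> * I\<^sub>2 \<omega> * z_star (W \<omega>))"
        using range by (auto simp: ray_def)
    qed
    have Q: "{x<..} \<times> {y<..} \<in> sets (borel :: (real \<times> real) measure)"
      by (intro borel_open open_Times) auto
    have "measure (distr M borel (\<lambda>\<omega>. (X \<omega>, Y \<omega>))) ({x<..} \<times> {y<..}) = measure M (E x y)"
      by (subst measure_distr[OF _ Q]) (auto simp: E_def intro!: arg_cong[where f = "measure M"])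
    moreover have "measure (distr N borel (\<lambda>\<omega>. (R \<omega> * I\<^sub>1 \<omega> * W \<omega>, \<rho> * R \<omega> * I\<^sub>1 \<omega> * W \<omega> + R \<omega> * I\<^sub>2 \<omega> * z_star (W \<omega>))))
        ({x<..} \<times> {y<..}) = prob (E' x y)"
      by (subst measure_distr[OF meas Q]) (auto simp: E'_def intro!: arg_cong[where f = prob])
    ultimately show ?thesis unfolding XY_distr by simp
  qed
  define \<Lambda> where "\<Lambda> \<delta> \<eta> = p11 * (h b * (b * (c * a + 1) * exp (- ((c * a * \<eta> + \<delta>) / (c * a + 1)))))" for \<delta> \<eta>
  have \<Lambda>_pos: "0 < \<Lambda> \<delta> \<eta>" for \<delta> \<eta>
    unfolding \<Lambda>_def using p11 b a c \<open>\<forall>x\<in>{0<..<1}. 0 < h x\<close> by (intro mult_pos_pos add_pos_pos) auto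

  \<comment> \<open>The limit along sequences of levels and parameters\<close>
  have main: "(\<lambda>n. measure M (E (x n * (1 + p n / v (a\<^sub>\<rho> * x n))) (a * x n * (1 + q n / v (a\<^sub>\<rho> * x n))))
      / (\<Lambda> (p n) (q n) * (T (a\<^sub>\<rho> * x n) / v (a\<^sub>\<rho> * x n)))) \<longlonglongrightarrow> 1"
    if x: "filterlim x at_top sequentially" and p: "p \<longlonglongrightarrow> \<delta>" and q: "q \<longlonglongrightarrow> \<eta>"
      and nonneg: "\<And>n. 0 \<le> p n" "\<And>n. 0 \<le> q n" for x p q :: "nat \<Rightarrow> real" and \<delta> \<eta>
  proof -
    define y where "y n = a\<^sub>\<rho> * x n" for n
    have xy: "x n = b * y n" for n using b by (simp add: y_def b_def)
    have y: "filterlim y at_top sequentially" unfolding y_def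
      by (rule filterlim_tendsto_pos_mult_at_top[OF tendsto_const _ x]) (use admissible_pos(1)[OF adm] in simp)
    define V where "V n = y n * w (y n)" for n
    have V: "filterlim V at_top sequentially"
      unfolding V_def by (rule filterlim_compose[OF G.scaled_at_top y])
    define x1 where "x1 n = b * y n * (1 + p n / V n)" for n
    define y1 where "y1 n = a * b * y n * (1 + q n / V n)" for n
    define J where "J n = (LINT s|lborel. dens01 s * section_tail T ray (x1 n) (y1 n) s)" for n
    have pos: "\<forall>\<^sub>F n in sequentially. 0 < y n \<and> 0 < V n"
      using y V by (auto simp: filterlim_at_top_dense intro!: eventually_conj)
    have bounds: "\<forall>\<^sub>F n in sequentially. p11 * J n \<le> prob (E' (x1 n) (y1 n)) \<and> prob (E' (x1 n) (y1 n)) \<le> p11 * J n + T (k * y n)"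
      using pos
    proof eventually_elim
      case (elim n)
      have "b * y n * 1 \<le> x1 n" unfolding x1_def
        using elim nonneg(1)[of n] b by (intro mult_left_mono) auto
      moreover have "0 < b * y n" using elim b by simp
      ultimately have x1: "0 < x1 n" by linarith
      have y1': "a * b * y n * 1 \<le> y1 n" unfolding y1_def
        using elim nonneg(2)[of n] a b by (intro mult_left_mono) auto
      moreover have "0 < a * b * y n" using elim ab by simp
      ultimately have y1: "0 < y1 n" by linarith
      note jb = joint_tail_bounds[OF x1 y1, folded E'_def p11_def T_tail, folded J_def]
      have "(if 0 < \<rho> then T (y1 n / \<rho>) else 0) \<le> T (k * y n)"
      proof (cases "0 < \<rho>")
        case True
        then have "k * y n \<le> y1 n / \<rho>"
          using y1' by (simp add: k_def divide_right_mono)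
        then show ?thesis using True G.tail_le by simp
      qed (use T_pos[of "k * y n"] in simp)
      with jb show ?case by linarith
    qed
    have lim: "(\<lambda>n. p11 * (V n / T (y n) * J n)) \<longlonglongrightarrow> \<Lambda> \<delta> \<eta>"
      using tendsto_mult[OF tendsto_const C.ray_crossing_limit[OF y p q nonneg], of p11] dens01_eq[of b] b
      unfolding \<Lambda>_def J_def x1_def y1_def V_def by simp
    have lim_rest: "(\<lambda>n. V n * T (k * y n) / T (y n)) \<longlonglongrightarrow> 0"
      unfolding V_def by (rule filterlim_compose[OF G.tail_dilation_negligible[OF k] y])
    have "(\<lambda>n. V n / T (y n) * prob (E' (x1 n) (y1 n))) \<longlonglongrightarrow> \<Lambda> \<delta> \<eta>"
    proof (rule tendsto_sandwich)
      show "\<forall>\<^sub>F n in sequentially. p11 * (V n / T (y n) * J n) \<le> V n / T (y n) * prob (E' (x1 n) (y1 n))"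
        using bounds pos
      proof eventually_elim
        case (elim n)
        have "V n / T (y n) * (p11 * J n) \<le> V n / T (y n) * prob (E' (x1 n) (y1 n))"
          using elim T_pos[of "y n"] by (intro mult_left_mono) auto
        then show ?case by (simp only: mult_ac)
      qed
      show "\<forall>\<^sub>F n in sequentially. V n / T (y n) * prob (E' (x1 n) (y1 n)) \<le> p11 * (V n / T (y n) * J n) + V n * T (k * y n) / T (y n)"
        using bounds pos
      proof eventually_elim
        case (elim n)
        have "V n / T (y n) * prob (E' (x1 n) (y1 n)) \<le> V n / T (y n) * (p11 * J n + T (k * y n))"
          using elim T_pos[of "y n"] by (intro mult_left_mono) auto
        also have "\<dots> = p11 * (V n / T (y n) * J n) + V n * T (k * y n) / T (y n)"
          by (simp add: distrib_left)
        finally show ?case .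
      qed
      show "(\<lambda>n. p11 * (V n / T (y n) * J n) + V n * T (k * y n) / T (y n)) \<longlonglongrightarrow> \<Lambda> \<delta> \<eta>"
        using tendsto_add[OF lim lim_rest] by simp
    qed (rule lim)
    \<comment> \<open>The normalisation contains the moving parameters rather than their limits;
      since \<open>\<Lambda>\<close> is continuous and positive, the quotient still tends to
      1.\<close>
    moreover have "(\<lambda>n. \<Lambda> (p n) (q n)) \<longlonglongrightarrow> \<Lambda> \<delta> \<eta>"
      unfolding \<Lambda>_def by (intro tendsto_intros p q) (use a c in \<open>auto simp: add_pos_pos less_imp_neq[symmetric]\<close>)
    ultimately have "(\<lambda>n. V n / T (y n) * prob (E' (x1 n) (y1 n)) / \<Lambda> (p n) (q n)) \<longlonglongrightarrow> \<Lambda> \<delta> \<eta> / \<Lambda> \<delta> \<eta>"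
      by (rule tendsto_divide) (use \<Lambda>_pos[of \<delta> \<eta>] in simp)
    then have "(\<lambda>n. V n / T (y n) * prob (E' (x1 n) (y1 n)) / \<Lambda> (p n) (q n)) \<longlonglongrightarrow> 1"
      using \<Lambda>_pos[of \<delta> \<eta>] by simp
    then show ?thesis
    proof (rule tendsto_cong[THEN iffD1, rotated])
      show "\<forall>\<^sub>F n in sequentially. V n / T (y n) * prob (E' (x1 n) (y1 n)) / \<Lambda> (p n) (q n) =
        measure M (E (x n * (1 + p n / v (a\<^sub>\<rho> * x n))) (a * x n * (1 + q n / v (a\<^sub>\<rho> * x n))))
          / (\<Lambda> (p n) (q n) * (T (a\<^sub>\<rho> * x n) / v (a\<^sub>\<rho> * x n)))"
        using pos
      proof eventually_elim
        case (elim n)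
        have vV: "v (y n) = V n" using v elim by (simp add: V_def)
        show ?case
          unfolding y_def[symmetric] unfolding vV E_prob x1_def y1_def xy by (simp add: mult_ac)
      qed
    qed
  qed

  \<comment> \<open>Local uniformity in the two parameters\<close>
  show "asymp_equiv_loc_unif at_top ({0..} \<times> {0..})
      (\<lambda>x (\<delta>, \<eta>). measure M {\<omega>\<in>space M. X \<omega> > x * (1 + \<delta> / v (a\<^sub>\<rho> * x)) \<and>
                                          Y \<omega> > a * x * (1 + \<eta> / v (a\<^sub>\<rho> * x))})
      (\<lambda>x (\<delta>, \<eta>). measure N {\<omega>\<in>space N. I\<^sub>1 \<omega> = 1 \<and> I\<^sub>2 \<omega> = 1} *
         (h (1 / a\<^sub>\<rho>) / a\<^sub>\<rho>) * (c * a + 1) *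
         exp (- ((c * a * \<eta> + \<delta>) / (c * a + 1))) *
         ((1 - F (a\<^sub>\<rho> * x)) / v (a\<^sub>\<rho> * x)))"
    unfolding asymp_equiv_loc_unif_def
  proof (intro allI impI uniform_limit_at_top_sequentialI)
    fix K :: "(real \<times> real) set" and x :: "nat \<Rightarrow> real" and P and r :: "real \<times> real"
    assume K: "compact K \<and> K \<subseteq> {0..} \<times> {0..}"
    then show "compact K" by simp
    assume x: "filterlim x at_top sequentially" and P: "\<And>n. P n \<in> K" "P \<longlonglongrightarrow> r"
    have "0 \<le> fst (P n)" "0 \<le> snd (P n)" for n
      using subsetD[OF conjunct2[OF K] P(1)[of n]] by (simp_all add: mem_Times_iff)
    from main[OF x tendsto_fst[OF P(2)] tendsto_snd[OF P(2)] this]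
    show "(\<lambda>n. (case P n of (\<delta>, \<eta>) \<Rightarrow> measure M {\<omega>\<in>space M. X \<omega> > x n * (1 + \<delta> / v (a\<^sub>\<rho> * x n)) \<and>
                                          Y \<omega> > a * x n * (1 + \<eta> / v (a\<^sub>\<rho> * x n))}) /
        (case P n of (\<delta>, \<eta>) \<Rightarrow> measure N {\<omega>\<in>space N. I\<^sub>1 \<omega> = 1 \<and> I\<^sub>2 \<omega> = 1} *
         (h (1 / a\<^sub>\<rho>) / a\<^sub>\<rho>) * (c * a + 1) *
         exp (- ((c * a * \<eta> + \<delta>) / (c * a + 1))) *
         ((1 - F (a\<^sub>\<rho> * x n)) / v (a\<^sub>\<rho> * x n)))) \<longlonglongrightarrow> 1"
      by (simp add: case_prod_beta E_def \<Lambda>_def p11_def T_def b_def mult.assoc)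
  qed
qed

end
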